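(* Let $L\in\mathbb{N}$, $L\ge1$. Suppose $\psi\in L^2(\mathbb{R})$ has $L$ vanishing moments and $L+1$ absolutely convergent moments, i.e. $\int_{\mathbb{R}}|t|^k|\psi(t)|\,dt<\infty$ for $k=0,\dots,L$ and $\int_{\mathbb{R}}t^k\psi(t)\,dt=0$ for $k=0,\dots,L-1$. Suppose further that $\psi$ is $L$-times differentiable, that all derivatives $\psi^{(k)}$, $k=0,\dots,L$, are integrable, and that $$\int_{\mathbb{R}}\sup_{(\delta,\tau)\in U}|\psi^{(L)}(\tau t+\delta)|\,dt<\infty$$ for some compact neighbourhood $U\subset\mathcal{A}ff$ of $(0,1)$. Then $\mathrm{osc}_U(W_\psi\psi)\in L^1_{w_\rho}(\mathcal{A}ff)$ for $0\le\rho<L-\tfrac12$, and in particular $\psi\in\mathcal{B}_{w_\rho}$ for such values of $\rho$.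
   Context: $\mathbb{R}^*=\mathbb{R}\setminus\{0\}$. The affine group $\mathcal{A}ff$ is $\mathbb{R}\times\mathbb{R}^*$ with $(b_1,a_1)(b_2,a_2)=(b_1+a_1b_2,a_1a_2)$, neutral element $(0,1)$ and left Haar measure $db\,da/a^2$. For $f,g\in L^2(\mathbb{R})$, $W_gf(b,a)=|a|^{-1/2}\int_{\mathbb{R}}f(t)\overline{g\left(\frac{t-b}{a}\right)}\,dt$. For $\rho\ge0$, $w_\rho(b,a)=|a|^\rho+|a|^{-\rho}$; $L^1_{w_\rho}(\mathcal{A}ff)$ is the space of measurable $F$ with $\int\int|F(b,a)|w_\rho(b,a)\,db\,da/a^2<\infty$. For a compact neighbourhood $U$ of $(0,1)$, $\mathrm{osc}_U(F)(x)=\operatorname{ess\,sup}_{u\in U}|F(ux)-F(x)|$ for $x\in\mathcal{A}ff$. $\mathcal{B}_{w_\rho}$ is the set of $\psi\in L^2(\mathbb{R})$ such that $W_\psi\psi\in L^1_{w_\rho}(\mathcal{A}ff)$ and $\mathrm{osc}_U(W_\psi\psi)\in L^1_{w_\rho}(\mathcal{A}ff)$ for some (equivalently, every) compact neighbourhood $U$ of $(0,1)$. *)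

theory Defs
  imports "HOL-Analysis.Analysis" "HOL-Probability.Essential_Supremum"
begin

text \<open>Elements of the affine group are pairs \<open>(b, a)\<close> with \<open>a \<noteq> 0\<close>; its topology is the one induced
  from the plane.\<close>

definition aff :: "(real \<times> real) set" where
  "aff = UNIV \<times> (- {0})"

definition aff_mult :: "real \<times> real \<Rightarrow> real \<times> real \<Rightarrow> real \<times> real" where
  "aff_mult x y = (fst x + snd x * fst y, snd x * snd y)"

definition aff_haar :: "(real \<times> real) measure" where
  "aff_haar = density (restrict_space lebesgue aff) (\<lambda>(b, a). ennreal (1 / a\<^sup>2))"

text \<open>A subset of the open set \<open>aff\<close> is compact (a neighbourhood) in the group iff it is so in the
  plane. Such a set need not be contained in the identity component.\<close>

definition aff_compact_nbhd :: "(real \<times> real) set \<Rightarrow> bool" where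
  "aff_compact_nbhd U \<longleftrightarrow> U \<subseteq> aff \<and> compact U \<and> (0, 1) \<in> interior U"

definition L2 :: "(real \<Rightarrow> complex) set" where
  "L2 = {f. f \<in> borel_measurable lebesgue \<and> integrable lebesgue (\<lambda>t. (cmod (f t))\<^sup>2)}"

definition wavelet_transform ::
    "(real \<Rightarrow> complex) \<Rightarrow> (real \<Rightarrow> complex) \<Rightarrow> real \<times> real \<Rightarrow> complex" where
  "wavelet_transform g f = (\<lambda>(b, a).
     of_real (\<bar>a\<bar> powr (- 1 / 2)) * (LINT t|lebesgue. f t * cnj (g ((t - b) / a))))"

definition aff_weight :: "real \<Rightarrow> real \<times> real \<Rightarrow> real" where
  "aff_weight \<rho> = (\<lambda>(b, a). \<bar>a\<bar> powr \<rho> + \<bar>a\<bar> powr (- \<rho>))"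

text \<open>The weighted \<open>L\<^sup>1\<close> space, first for functions with values in \<open>[0, \<infinity>]\<close> (oscillations can be
  infinite), then for complex-valued functions.\<close>

definition aff_L1_ennreal :: "real \<Rightarrow> (real \<times> real \<Rightarrow> ennreal) set" where
  "aff_L1_ennreal \<rho> = {G. G \<in> borel_measurable aff_haar \<and>
     (\<integral>\<^sup>+ x. G x * ennreal (aff_weight \<rho> x) \<partial>aff_haar) < \<infinity>}"

definition aff_L1 :: "real \<Rightarrow> (real \<times> real \<Rightarrow> complex) set" where
  "aff_L1 \<rho> = {F. F \<in> borel_measurable aff_haar \<and>
     (\<integral>\<^sup>+ x. ennreal (cmod (F x)) * ennreal (aff_weight \<rho> x) \<partial>aff_haar) < \<infinity>}"

definition osc ::
    "(real \<times> real) set \<Rightarrow> (real \<times> real \<Rightarrow> complex) \<Rightarrow> real \<times> real \<Rightarrow> ennreal" where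
  "osc U F x = esssup (restrict_space aff_haar U) (\<lambda>u. ennreal (cmod (F (aff_mult u x) - F x)))"

definition B_space :: "real \<Rightarrow> (real \<Rightarrow> complex) set" where
  "B_space \<rho> = {\<psi> \<in> L2. wavelet_transform \<psi> \<psi> \<in> aff_L1 \<rho> \<and>
     (\<exists>U. aff_compact_nbhd U \<and> osc U (wavelet_transform \<psi> \<psi>) \<in> aff_L1_ennreal \<rho>)}"

definition nth_derivative :: "nat \<Rightarrow> (real \<Rightarrow> complex) \<Rightarrow> real \<Rightarrow> complex" where
  "nth_derivative k f = ((\<lambda>g t. vector_derivative g (at t)) ^^ k) f"

definition times_differentiable :: "nat \<Rightarrow> (real \<Rightarrow> complex) \<Rightarrow> bool" where
  "times_differentiable n f \<longleftrightarrow> (\<forall>k<n. \<forall>t. nth_derivative k f differentiable (at t))"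

end

theory Submission
  imports Defs
begin

text \<open>Since \<open>\<psi>\<close> has \<open>L\<close> vanishing moments, it is the \<open>L\<close>-th derivative of an integrable function \<open>\<Psi>\<close>, so
  \<open>L\<close> integrations by parts replace \<open>\<psi>, \<psi>\<close> in \<open>W (u x)\<close>, with \<open>u = (\<delta>, \<tau>)\<close> and \<open>x = (b, a)\<close>, by
  \<open>\<Psi>, \<psi>\<^sup>(\<^sup>L\<^sup>)\<close>, at the gain of a power of \<open>a\<close>. Two changes of variables put the dependence on \<open>u\<close> on
  either factor: for \<open>\<bar>a\<bar> \<le> 1\<close> one gets \<open>\<bar>a\<bar> powr (L + 1 / 2)\<close> times the integral of
  \<open>\<Psi> t * cnj (\<psi>\<^sup>(\<^sup>L\<^sup>) (\<tau> * (a * t + b) + \<delta>))\<close>, and for \<open>\<bar>a\<bar> \<ge> 1\<close> one gets \<open>\<bar>a\<bar> powr (- L - 1 / 2)\<close> times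
  the integral of \<open>\<Psi> (\<tau> * s + \<delta>) * cnj (\<psi>\<^sup>(\<^sup>L\<^sup>) ((s - b) / a))\<close>. Both \<open>\<psi>\<^sup>(\<^sup>L\<^sup>)\<close> and \<open>\<Psi>\<close> are bounded by
  integrable functions that decrease in the modulus of the argument, and such a bound survives
  the supremum over \<open>u \<in> U\<close>. Integrating in \<open>b\<close> and then in \<open>a\<close> bounds
  \<open>sup\<^bsub>u \<in> U\<^esub> \<bar>W (u x)\<bar>\<close>, hence both \<open>W\<close> and its oscillation, in the weighted norm;
  convergence at \<open>a = 0\<close> is what requires \<open>\<rho> < L - 1 / 2\<close>.\<close>

section \<open>Integrable derivatives and integration by parts\<close>

text \<open>A derivative need not be continuous, but it is the pointwise limit of the continuous
  difference quotients with step \<open>inverse (real (Suc n))\<close>.\<close>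

lemma borel_measurable_vector_derivative:
  fixes f f' :: "real \<Rightarrow> complex"
  assumes d: "\<And>t. (f has_vector_derivative f' t) (at t)"
  shows "f' \<in> borel_measurable borel"
proof (rule borel_measurable_LIMSEQ_metric)
  have c: "continuous_on UNIV f"
    using d by (meson continuous_at_imp_continuous_on has_vector_derivative_continuous)
  then show "(\<lambda>t. (f (t + inverse (real (Suc n))) - f t) /\<^sub>R inverse (real (Suc n))) \<in> borel_measurable borel" for n
    by (intro borel_measurable_continuous_onI continuous_intros continuous_on_compose2[OF c]) auto
  fix t :: real
  have "((\<lambda>h. (f (t + h) - f t) /\<^sub>R h) \<longlongrightarrow> f' t) (at 0)"
  proof -
    have "((\<lambda>h. norm (f (t + h) - f t - h *\<^sub>R f' t) / norm h) \<longlongrightarrow> 0) (at 0)"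
      using d[of t] by (simp add: has_vector_derivative_def has_derivative_at)
    moreover have "norm (f (t + h) - f t - h *\<^sub>R f' t) / norm h = norm ((f (t + h) - f t) /\<^sub>R h - f' t)"
      if "h \<noteq> 0" for h :: real
    proof -
      have "(f (t + h) - f t) /\<^sub>R h - f' t = (f (t + h) - f t - h *\<^sub>R f' t) /\<^sub>R h"
        using that by (simp add: scaleR_diff_right)
      then show ?thesis by (simp add: divide_inverse_commute)
    qed
    then have "\<forall>\<^sub>F h in at 0. norm (f (t + h) - f t - h *\<^sub>R f' t) / norm h = norm ((f (t + h) - f t) /\<^sub>R h - f' t)"
      by (auto simp: eventually_at_filter)
    ultimately have "((\<lambda>h. norm ((f (t + h) - f t) /\<^sub>R h - f' t)) \<longlongrightarrow> 0) (at 0)"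
      by (rule Lim_transform_eventually)
    then show ?thesis
      using Lim_null tendsto_norm_zero_iff by blast
  qed
  moreover have "filterlim (\<lambda>n. inverse (real (Suc n))) (at 0) sequentially"
    unfolding filterlim_at using LIMSEQ_inverse_real_of_nat by auto
  ultimately show "(\<lambda>n. (f (t + inverse (real (Suc n))) - f t) /\<^sub>R inverse (real (Suc n))) \<longlonglongrightarrow> f' t"
    by (rule filterlim_compose)
qed

text \<open>For the gauge integral the fundamental theorem holds for every derivative, continuous or
  not; integrability of \<open>f'\<close> makes the gauge and Lebesgue integrals agree.\<close>

lemma FTC_lborel:
  fixes f f' :: "real \<Rightarrow> complex"
  assumes d: "\<And>t. (f has_vector_derivative f' t) (at t)"
    and i: "integrable lborel f'" and "a \<le> b"
  shows "(LINT t:{a..b}|lborel. f' t) = f b - f a"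
proof -
  have "set_integrable lborel {a..b} f'"
    using i by (simp add: set_integrable_def integrable_mult_indicator)
  then have "(LINT t:{a..b}|lborel. f' t) = integral {a..b} f'"
    by (rule set_borel_integral_eq_integral)
  moreover have "(f' has_integral (f b - f a)) {a..b}"
    using \<open>a \<le> b\<close> d has_vector_derivative_at_within by (intro fundamental_theorem_of_calculus) blast+
  ultimately show ?thesis by (simp add: integral_unique)
qed

text \<open>Its use is to make functions with integrable derivative bounded, so that their products
  with integrable functions are again integrable.\<close>

lemma bounded_by_integrable_derivative:
  fixes f f' :: "real \<Rightarrow> complex"
  assumes d: "\<And>t. (f has_vector_derivative f' t) (at t)"
    and i: "integrable lborel f'"
  shows "cmod (f y - f x) \<le> (LINT t|lborel. cmod (f' t))"
proof -
  have *: "cmod (f b - f a) \<le> (LINT t|lborel. cmod (f' t))" if "a \<le> b" for a b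
  proof -
    have "cmod (f b - f a) = cmod (LINT t|lborel. indicator {a..b} t *\<^sub>R f' t)"
      using FTC_lborel[OF d i that] by (simp add: set_lebesgue_integral_def)
    also have "\<dots> \<le> (LINT t|lborel. cmod (indicator {a..b} t *\<^sub>R f' t))"
      by (rule integral_norm_bound)
    also have "\<dots> \<le> (LINT t|lborel. cmod (f' t))"
      using i by (intro integral_mono integrable_norm integrable_mult_indicator) (auto simp: indicator_def)
    finally show ?thesis .
  qed
  show ?thesis using *[of x y] *[of y x] by (cases "x \<le> y") (auto simp: norm_minus_commute)
qed

text \<open>Integrate \<open>f (t + 1) - f t = \<integral>\<^sub>0\<^sup>1 f' (t + s) ds\<close> over \<open>t\<close>: the left-hand side gives zero by
  translation invariance, the right-hand side gives the integral of \<open>f'\<close> by Fubini.\<close>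

lemma integral_derivative_eq_0:
  fixes f f' :: "real \<Rightarrow> complex"
  assumes d: "\<And>t. (f has_vector_derivative f' t) (at t)"
    and i: "integrable lborel f" "integrable lborel f'"
  shows "(LINT t|lborel. f' t) = 0"
proof -
  have [measurable]: "f' \<in> borel_measurable borel" using i by simp
  have sh: "integrable lborel (\<lambda>t. f' (s + t))" for s
    using lborel_integrable_real_affine[OF i(2), of 1 s] by simp
  have shi: "(LINT t|lborel. g (s + t)) = (LINT t|lborel. g t)" for s and g :: "real \<Rightarrow> complex"
    using lborel_integral_real_affine[of 1 g s] by simp
  have shr: "(LINT t|lborel. g (s + t)) = (LINT t|lborel. g t)" for s and g :: "real \<Rightarrow> real"
    using lborel_integral_real_affine[of 1 g s] by simp
  let ?h = "\<lambda>(s::real, t::real). indicator {0..1} s *\<^sub>R f' (s + t)"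
  have int: "integrable (lborel \<Otimes>\<^sub>M lborel) ?h"
  proof (rule lborel_pair.Fubini_integrable)
    show "?h \<in> borel_measurable (lborel \<Otimes>\<^sub>M lborel)" by measurable
    have "integrable lborel (\<lambda>s::real. indicator {0..1} s * (LINT t|lborel. cmod (f' t)))"
      by (intro integrable_mult_left) (simp add: integrable_indicator_iff)
    then show "integrable lborel (\<lambda>x. LINT y|lborel. norm (?h (x, y)))"
      by (simp add: shr[of "\<lambda>t. cmod (f' t)"])
    show "AE x in lborel. integrable lborel (\<lambda>y. ?h (x, y))"
      using sh by auto
  qed
  have ft: "(LINT s|lborel. ?h (s, t)) = f (1 + t) - f t" for t
  proof -
    have d': "((\<lambda>s. f (s + t)) has_vector_derivative f' (s + t)) (at s)" for s
      using vector_diff_chain_at[of "\<lambda>s. s + t" 1 s f "f' (s + t)"] d[of "s + t"]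
      by (simp add: o_def has_vector_derivative_add_const)
    have "(LINT s:{0..1}|lborel. f' (s + t)) = f (1 + t) - f (0 + t)"
      using sh[of t] by (intro FTC_lborel d') (simp_all add: add.commute)
    then show ?thesis by (simp add: set_lebesgue_integral_def)
  qed
  have "(LINT t|lborel. LINT s|lborel. ?h (s, t)) = (LINT s|lborel. LINT t|lborel. ?h (s, t))"
    using lborel_pair.Fubini_integral[of "\<lambda>s t. ?h (s, t)"] int by simp
  moreover have "(LINT t|lborel. LINT s|lborel. ?h (s, t)) = 0"
    using shi[of f 1] i lborel_integrable_real_affine[OF i(1), of 1 1]
    by (simp only: ft) (simp add: Bochner_Integration.integral_diff)
  moreover have "(LINT s|lborel. LINT t|lborel. ?h (s, t)) = (LINT t|lborel. f' t)"
    by (simp add: shi)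
  ultimately show ?thesis by simp
qed

text \<open>Both factors are bounded because their derivatives are integrable. Hence
  \<open>u * v\<close> and its derivative are integrable, the integral of the derivative vanishes,
  and no boundary terms appear.\<close>

lemma integral_by_parts_UNIV:
  fixes u v u' v' :: "real \<Rightarrow> complex"
  assumes du: "\<And>t. (u has_vector_derivative u' t) (at t)"
    and dv: "\<And>t. (v has_vector_derivative v' t) (at t)"
    and iu: "integrable lborel u" "integrable lborel u'"
    and iv: "integrable lborel v" "integrable lborel v'"
  shows "(LINT t|lborel. u' t * v t) = - (LINT t|lborel. u t * v' t)"
proof -
  have bdd: "\<exists>C. \<forall>t. cmod (g t) \<le> C"
    if "\<And>t. (g has_vector_derivative g' t) (at t)" "integrable lborel g'" for g g' :: "real \<Rightarrow> complex"
  proof (intro exI allI)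
    fix t
    show "cmod (g t) \<le> cmod (g 0) + (LINT t|lborel. cmod (g' t))"
      using bounded_by_integrable_derivative[OF that, of t 0] norm_triangle_sub[of "g t" "g 0"] by linarith
  qed
  have prod: "integrable lborel (\<lambda>t. g t * h t)"
    if g: "\<exists>C. \<forall>t. cmod (g t) \<le> C" "g \<in> borel_measurable borel" and h: "integrable lborel h"
    for g h :: "real \<Rightarrow> complex"
  proof -
    obtain C where C: "\<And>t. cmod (g t) \<le> C" using g by blast
    show ?thesis
    proof (rule Bochner_Integration.integrable_bound)
      show "integrable lborel (\<lambda>t. C * cmod (h t))" using h by simp
      show "(\<lambda>t. g t * h t) \<in> borel_measurable lborel" using g(2) h by measurable
      show "AE t in lborel. norm (g t * h t) \<le> norm (C * cmod (h t))"
      proof (intro AE_I2)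
        fix t
        have "0 \<le> C" using C[of t] norm_ge_zero order_trans by blast
        then show "norm (g t * h t) \<le> norm (C * cmod (h t))"
          using C[of t] by (simp add: norm_mult abs_mult mult_right_mono)
      qed
    qed
  qed
  note bu = bdd[OF du iu(2)] and bv = bdd[OF dv iv(2)]
  have m: "u \<in> borel_measurable borel" "v \<in> borel_measurable borel"
    using iu iv by simp_all
  have i1: "integrable lborel (\<lambda>t. u t * v' t)" by (rule prod[OF bu m(1) iv(2)])
  have i2: "integrable lborel (\<lambda>t. u' t * v t)"
    using prod[OF bv m(2) iu(2)] by (simp add: mult.commute)
  have "(LINT t|lborel. u t * v' t + u' t * v t) = 0"
  proof (rule integral_derivative_eq_0)
    show "((\<lambda>t. u t * v t) has_vector_derivative (u t * v' t + u' t * v t)) (at t)" for t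
      by (rule has_vector_derivative_mult[OF du dv])
    show "integrable lborel (\<lambda>t. u t * v t)" by (rule prod[OF bu m(1) iv(1)])
    show "integrable lborel (\<lambda>t. u t * v' t + u' t * v t)" using i1 i2 by simp
  qed
  then show ?thesis using i1 i2 by (simp add: add_eq_0_iff)
qed

lemma iterated_integral_by_parts:
  fixes u v :: "nat \<Rightarrow> real \<Rightarrow> complex"
  assumes "\<And>k t. k < n \<Longrightarrow> (u (Suc k) has_vector_derivative u k t) (at t)"
    and "\<And>k t. k < n \<Longrightarrow> (v k has_vector_derivative v (Suc k) t) (at t)"
    and "\<And>k. k \<le> n \<Longrightarrow> integrable lborel (u k)"
    and "\<And>k. k \<le> n \<Longrightarrow> integrable lborel (v k)"
  shows "(LINT t|lborel. u 0 t * v 0 t) = (- 1) ^ n * (LINT t|lborel. u n t * v n t)"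
  using assms
proof (induction n)
  case (Suc n)
  have "(LINT t|lborel. u n t * v n t) = - (LINT t|lborel. u (Suc n) t * v (Suc n) t)"
    by (rule integral_by_parts_UNIV) (use Suc.prems in auto)
  with Suc show ?case by simp
qed simp

section \<open>Antiderivatives and vanishing moments\<close>

definition antideriv :: "(real \<Rightarrow> complex) \<Rightarrow> real \<Rightarrow> complex" where
  "antideriv f t = (LINT r:{..t}|lborel. f r)"

lemma antideriv_has_vector_derivative:
  assumes c: "continuous_on UNIV f" and i: "integrable lborel f"
  shows "(antideriv f has_vector_derivative f t) (at t)"
proof -
  have si: "set_integrable lborel A f" if "A \<in> sets borel" for A
    using i that by (simp add: set_integrable_def integrable_mult_indicator)
  \<comment> \<open>The base point \<open>t - 1\<close> lies strictly to the left of
    \<open>t\<close>. On the neighbourhood \<open>{t - 1<..}\<close> of \<open>t\<close>, the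
    integral from minus infinity thus differs by a constant from one over a compact interval, to
    which the local theorem applies.\<close>
  have eq: "antideriv f (t - 1) + integral {t - 1..s} f = antideriv f s" if "t - 1 < s" for s
  proof -
    have "antideriv f s = (LINT r:{..t - 1} \<union> {t - 1<..s}|lborel. f r)"
      using that by (simp add: antideriv_def ivl_disj_un)
    also have "\<dots> = antideriv f (t - 1) + (LINT r:{t - 1<..s}|lborel. f r)"
      unfolding antideriv_def by (rule set_integral_Un) (auto intro: si)
    also have "(LINT r:{t - 1<..s}|lborel. f r) = integral {t - 1<..s} f"
      by (intro set_borel_integral_eq_integral si) simp
    also have "\<dots> = integral {t - 1..s} f"
      by (rule integral_subset_negligible) (auto intro!: negligible_subset[OF negligible_sing[of "t - 1"]])
    finally show ?thesis by simp
  qed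
  have "((\<lambda>s. integral {t - 1..s} f) has_vector_derivative f t) (at t within {t - 1..t + 1})"
    by (rule integral_has_vector_derivative) (auto intro: continuous_on_subset[OF c])
  then have "((\<lambda>s. antideriv f (t - 1) + integral {t - 1..s} f) has_vector_derivative f t) (at t within {t - 1..t + 1})"
    using has_vector_derivative_add[OF has_vector_derivative_const] by fastforce
  then have "((\<lambda>s. antideriv f (t - 1) + integral {t - 1..s} f) has_vector_derivative f t) (at t)"
    by (simp add: at_within_Icc_at)
  then show ?thesis
    by (rule has_vector_derivative_transform_within_open[of _ _ _ "{t - 1<..}"]) (auto simp: eq)
qed

lemma norm_set_integral_le_nn_integral:
  fixes f :: "real \<Rightarrow> complex"
  assumes "integrable lborel f" "A \<in> sets borel" "A \<subseteq> B"
  shows "ennreal (cmod (LINT r:A|lborel. f r)) \<le> (\<integral>\<^sup>+ r. indicator B r * ennreal (cmod (f r)) \<partial>lborel)"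
proof -
  have "integrable lborel (\<lambda>r. indicator A r *\<^sub>R f r)"
    using assms by (simp add: integrable_mult_indicator)
  then have "ennreal (cmod (LINT r:A|lborel. f r)) \<le> (\<integral>\<^sup>+ r. ennreal (cmod (indicator A r *\<^sub>R f r)) \<partial>lborel)"
    unfolding set_lebesgue_integral_def by (rule integral_norm_bound_ennreal)
  also have "\<dots> \<le> (\<integral>\<^sup>+ r. indicator B r * ennreal (cmod (f r)) \<partial>lborel)"
    using assms(3) by (intro nn_integral_mono) (auto simp: indicator_def)
  finally show ?thesis .
qed

text \<open>For \<open>t \<le> 0\<close> the half-line \<open>{..t}\<close> already lies in the set
  on the right. For \<open>t > 0\<close> the zero mean turns the integral over \<open>{..t}\<close>
  into minus the integral over \<open>{t<..}\<close>, which lies in that set too.\<close>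

lemma norm_antideriv_le:
  assumes i: "integrable lborel f" and z: "(LINT t|lborel. f t) = 0"
  shows "ennreal (cmod (antideriv f t)) \<le> (\<integral>\<^sup>+ r. indicator {r. \<bar>t\<bar> \<le> \<bar>r\<bar>} r * ennreal (cmod (f r)) \<partial>lborel)"
proof (cases "t \<le> 0")
  case True
  then show ?thesis
    unfolding antideriv_def by (intro norm_set_integral_le_nn_integral i) auto
next
  case False
  have si: "set_integrable lborel A f" if "A \<in> sets borel" for A
    using i that by (simp add: set_integrable_def integrable_mult_indicator)
  have "(LINT r:{..t} \<union> {t<..}|lborel. f r) = antideriv f t + (LINT r:{t<..}|lborel. f r)"
    unfolding antideriv_def by (rule set_integral_Un) (auto intro: si)
  moreover have "{..t} \<union> {t<..} = UNIV" by auto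
  ultimately have "antideriv f t = - (LINT r:{t<..}|lborel. f r)"
    using z by (simp add: set_lebesgue_integral_def eq_neg_iff_add_eq_0)
  then show ?thesis
    using False norm_set_integral_le_nn_integral[OF i, of "{t<..}" "{r. \<bar>t\<bar> \<le> \<bar>r\<bar>}"] by (auto simp: subset_iff)
qed

text \<open>This is the invariant carried through repeated antiderivatives: each one uses up a
  single moment. Continuity is included so that the next antiderivative is differentiable at every
  point.\<close>

definition vanishing_moments :: "nat \<Rightarrow> (real \<Rightarrow> complex) \<Rightarrow> bool" where
  "vanishing_moments n f \<longleftrightarrow> continuous_on UNIV f \<and>
     (\<forall>m\<le>n. integrable lborel (\<lambda>t. of_real (t ^ m) * f t)) \<and>
     (\<forall>m<n. (LINT t|lborel. of_real (t ^ m) * f t) = 0)"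

lemma vanishing_moments_integrable: "vanishing_moments n f \<Longrightarrow> integrable lborel f"
  by (auto simp: vanishing_moments_def dest: spec[of _ 0])

text \<open>Inserting the tail bound and exchanging integrals bounds the absolute moment of order
  \<open>m\<close> of the antiderivative by twice that of order \<open>Suc m\<close> of
  \<open>f\<close>. The moments vanish because the derivative of
  \<open>t ^ Suc m * antideriv f t\<close> has integral zero, and its two terms are the moment
  integrands of order \<open>Suc m\<close> for \<open>f\<close> and, up to the factor
  \<open>Suc m\<close>, of order \<open>m\<close> for the antiderivative.\<close>

lemma vanishing_moments_antideriv:
  assumes v: "vanishing_moments (Suc n) f"
  shows "vanishing_moments n (antideriv f)"
    and "(antideriv f has_vector_derivative f t) (at t)"
    and "ennreal (cmod (antideriv f t)) \<le> (\<integral>\<^sup>+ r. indicator {r. \<bar>t\<bar> \<le> \<bar>r\<bar>} r * ennreal (cmod (f r)) \<partial>lborel)"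
proof -
  have c: "continuous_on UNIV f" using v by (simp add: vanishing_moments_def)
  have i: "integrable lborel f" using v by (rule vanishing_moments_integrable)
  have z: "(LINT t|lborel. f t) = 0"
    using v by (auto simp: vanishing_moments_def dest: spec[of _ 0])
  have d: "(antideriv f has_vector_derivative f t) (at t)" for t
    by (rule antideriv_has_vector_derivative[OF c i])
  have le: "ennreal (cmod (antideriv f t)) \<le> (\<integral>\<^sup>+ r. indicator {r. \<bar>t\<bar> \<le> \<bar>r\<bar>} r * ennreal (cmod (f r)) \<partial>lborel)" for t
    by (rule norm_antideriv_le[OF i z])
  show "(antideriv f has_vector_derivative f t) (at t)" by (rule d)
  show "ennreal (cmod (antideriv f t)) \<le> (\<integral>\<^sup>+ r. indicator {r. \<bar>t\<bar> \<le> \<bar>r\<bar>} r * ennreal (cmod (f r)) \<partial>lborel)" by (rule le)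
  have cF: "continuous_on UNIV (antideriv f)"
    using d by (meson continuous_at_imp_continuous_on has_vector_derivative_continuous)
  have [measurable]: "f \<in> borel_measurable borel" "antideriv f \<in> borel_measurable borel"
    using i borel_measurable_continuous_onI[OF cF] by auto
  have int: "integrable lborel (\<lambda>t. of_real (t ^ m) * antideriv f t)" if "m \<le> n" for m
  proof (rule integrableI_bounded)
    show "(\<lambda>t. of_real (t ^ m) * antideriv f t) \<in> borel_measurable lborel" by measurable
    have len: "(\<integral>\<^sup>+ t. indicator {t. \<bar>t\<bar> \<le> \<bar>r\<bar>} t \<partial>lborel) = ennreal (2 * \<bar>r\<bar>)" for r :: real
    proof -
      have "{t. \<bar>t\<bar> \<le> \<bar>r\<bar>} = {- \<bar>r\<bar>..\<bar>r\<bar>}" by auto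
      then show ?thesis by simp
    qed
    have "(\<integral>\<^sup>+ t. ennreal (norm (of_real (t ^ m) * antideriv f t)) \<partial>lborel)
        \<le> (\<integral>\<^sup>+ t. \<integral>\<^sup>+ r. ennreal (\<bar>t\<bar> ^ m) * (indicator {r. \<bar>t\<bar> \<le> \<bar>r\<bar>} r * ennreal (cmod (f r))) \<partial>lborel \<partial>lborel)"
      using le by (intro nn_integral_mono)
        (simp add: nn_integral_cmult norm_mult ennreal_mult norm_power mult_left_mono)
    also have "\<dots> = (\<integral>\<^sup>+ r. \<integral>\<^sup>+ t. ennreal (\<bar>t\<bar> ^ m) * (indicator {r. \<bar>t\<bar> \<le> \<bar>r\<bar>} r * ennreal (cmod (f r))) \<partial>lborel \<partial>lborel)"
    proof (rule lborel_pair.Fubini'[symmetric])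
      show "(\<lambda>(t, r). ennreal (\<bar>t\<bar> ^ m) * (indicator {r. \<bar>t\<bar> \<le> \<bar>r\<bar>} r * ennreal (cmod (f r))))
        \<in> borel_measurable (lborel \<Otimes>\<^sub>M lborel)"
        unfolding indicator_def mem_Collect_eq of_bool_def by measurable
    qed
    also have "\<dots> \<le> (\<integral>\<^sup>+ r. \<integral>\<^sup>+ t. ennreal (\<bar>r\<bar> ^ m * cmod (f r)) * indicator {t. \<bar>t\<bar> \<le> \<bar>r\<bar>} t \<partial>lborel \<partial>lborel)"
      by (intro nn_integral_mono) (auto simp: indicator_def ennreal_mult[symmetric] intro!: mult_right_mono power_mono ennreal_leI)
    also have "\<dots> = (\<integral>\<^sup>+ r. ennreal (\<bar>r\<bar> ^ m * cmod (f r)) * ennreal (2 * \<bar>r\<bar>) \<partial>lborel)"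
      by (simp add: nn_integral_cmult len)
    also have "\<dots> = (\<integral>\<^sup>+ r. 2 * ennreal (norm (of_real (r ^ Suc m) * f r)) \<partial>lborel)"
    proof (intro nn_integral_cong)
      fix r :: real
      have "\<bar>r\<bar> ^ m * cmod (f r) * (2 * \<bar>r\<bar>) = 2 * norm (of_real (r ^ Suc m) * f r)"
        by (simp add: norm_mult norm_power power_abs)
      then show "ennreal (\<bar>r\<bar> ^ m * cmod (f r)) * ennreal (2 * \<bar>r\<bar>) = 2 * ennreal (norm (of_real (r ^ Suc m) * f r))"
        by (metis abs_ge_zero ennreal_mult ennreal_numeral mult_nonneg_nonneg norm_ge_zero zero_le_numeral zero_le_power)
    qed
    also have "\<dots> = 2 * (\<integral>\<^sup>+ r. ennreal (norm (of_real (r ^ Suc m) * f r)) \<partial>lborel)"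
      by (rule nn_integral_cmult) measurable
    also have "\<dots> < \<infinity>"
      using v that by (auto simp: vanishing_moments_def integrable_iff_bounded ennreal_mult_less_top)
    finally show "(\<integral>\<^sup>+ t. ennreal (norm (of_real (t ^ m) * antideriv f t)) \<partial>lborel) < \<infinity>" .
  qed
  have zero: "(LINT t|lborel. of_real (t ^ m) * antideriv f t) = 0" if "m < n" for m
  proof -
    let ?d = "\<lambda>t. of_real (t ^ Suc m) * f t + of_nat (Suc m) * (of_real (t ^ m) * antideriv f t)"
    have i1: "integrable lborel (\<lambda>t. of_real (t ^ Suc m) * f t)"
      and z1: "(LINT t|lborel. of_real (t ^ Suc m) * f t) = 0"
      using v that by (auto simp: vanishing_moments_def simp del: power_Suc)
    have i2: "integrable lborel (\<lambda>t. of_real (t ^ m) * antideriv f t)" using int that by simp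
    have "(LINT t|lborel. ?d t) = 0"
    proof (rule integral_derivative_eq_0)
      show "((\<lambda>t. of_real (t ^ Suc m) * antideriv f t) has_vector_derivative ?d t) (at t)" for t
      proof -
        have "((\<lambda>t. t ^ Suc m) has_real_derivative of_nat (Suc m) * t ^ m) (at t)"
          using DERIV_pow[of "Suc m" t] by simp
        then have "((\<lambda>t. complex_of_real (t ^ Suc m)) has_vector_derivative of_real (of_nat (Suc m) * t ^ m)) (at t)"
          by (intro has_vector_derivative_of_real) (simp add: has_real_derivative_iff_has_vector_derivative)
        from has_vector_derivative_mult[OF this d[of t]] show ?thesis by (simp add: mult.assoc)
      qed
      \<comment> \<open>The moment of order \<open>Suc m\<close> of the antiderivative is available
        here because \<open>m < n\<close>.\<close>
      show "integrable lborel (\<lambda>t. of_real (t ^ Suc m) * antideriv f t)"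
        using int[of "Suc m"] that by simp
      show "integrable lborel ?d"
        using i1 i2 by (intro Bochner_Integration.integrable_add integrable_mult_right)
    qed
    moreover have "(LINT t|lborel. ?d t) = of_nat (Suc m) * (LINT t|lborel. of_real (t ^ m) * antideriv f t)"
      using i1 i2 z1 by (subst Bochner_Integration.integral_add) (simp_all del: of_nat_Suc power_Suc)
    ultimately show ?thesis by (simp del: of_nat_Suc)
  qed
  show "vanishing_moments n (antideriv f)"
    using cF int zero by (simp add: vanishing_moments_def)
qed

lemma vanishing_moments_iterated_antideriv:
  "vanishing_moments (k + n) f \<Longrightarrow> vanishing_moments n ((antideriv ^^ k) f)"
proof (induction k arbitrary: n)
  case (Suc k)
  then have "vanishing_moments (Suc n) ((antideriv ^^ k) f)" by simp
  then show ?case by (simp add: vanishing_moments_antideriv(1))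
qed simp

section \<open>Radial majorants\<close>

lemma one_plus_abs [simp]: "0 < 1 + \<bar>x::real\<bar>" "1 + \<bar>x\<bar> \<noteq> 0"
  by linarith+

text \<open>This turns an integrable \<open>G\<close> into a decreasing function of comparable
  integral: the mass of \<open>G\<close> at \<open>r\<close> is spread, with height
  \<open>1 / (1 + \<bar>r\<bar>)\<close>, over all arguments up to \<open>1 + \<bar>r\<bar>\<close>.
  The argument \<open>x\<close> stands for a multiple of \<open>1 + \<bar>y\<bar>\<close>.\<close>

definition envelope :: "(real \<Rightarrow> ennreal) \<Rightarrow> real \<Rightarrow> ennreal" where
  "envelope G x = (\<integral>\<^sup>+ r. indicator {r. x \<le> 1 + \<bar>r\<bar>} r * (G r * ennreal (1 / (1 + \<bar>r\<bar>))) \<partial>lborel)"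

lemma borel_measurable_envelope [measurable]:
  assumes [measurable]: "G \<in> borel_measurable borel"
  shows "envelope G \<in> borel_measurable borel"
  unfolding envelope_def indicator_def mem_Collect_eq of_bool_def by measurable

lemma antimono_envelope: "antimono (envelope G)"
  unfolding envelope_def by (intro antimonoI nn_integral_mono mult_right_mono) (auto simp: indicator_def)

text \<open>After exchanging integrals, for fixed \<open>r\<close> the admissible \<open>s\<close>
  lie in an interval of length \<open>2 * (1 + \<bar>r\<bar>) / c\<close>, which cancels the height
  \<open>1 / (1 + \<bar>r\<bar>)\<close>.\<close>

lemma nn_integral_envelope_le:
  assumes [measurable]: "G \<in> borel_measurable borel" and "c > 0"
  shows "(\<integral>\<^sup>+ s. envelope G (c * (1 + \<bar>s\<bar>)) \<partial>lborel) \<le> ennreal (2 / c) * (\<integral>\<^sup>+ r. G r \<partial>lborel)"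
proof -
  let ?F = "\<lambda>s r. indicator {r. c * (1 + \<bar>s\<bar>) \<le> 1 + \<bar>r\<bar>} r * (G r * ennreal (1 / (1 + \<bar>r\<bar>)))"
  have "(\<integral>\<^sup>+ s. envelope G (c * (1 + \<bar>s\<bar>)) \<partial>lborel) = (\<integral>\<^sup>+ r. \<integral>\<^sup>+ s. ?F s r \<partial>lborel \<partial>lborel)"
    unfolding envelope_def
  proof (rule lborel_pair.Fubini'[symmetric])
    show "(\<lambda>(s, r). ?F s r) \<in> borel_measurable (lborel \<Otimes>\<^sub>M lborel)"
      unfolding indicator_def mem_Collect_eq of_bool_def by measurable
  qed
  also have "\<dots> \<le> (\<integral>\<^sup>+ r. ennreal (2 / c) * G r \<partial>lborel)"
  proof (intro nn_integral_mono)
    fix r :: real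
    have "(\<integral>\<^sup>+ s. ?F s r \<partial>lborel)
        \<le> (\<integral>\<^sup>+ s. (G r * ennreal (1 / (1 + \<bar>r\<bar>))) * indicator {- ((1 + \<bar>r\<bar>) / c)..(1 + \<bar>r\<bar>) / c} s \<partial>lborel)"
    proof (intro nn_integral_mono)
      fix s :: real
      have "s \<in> {- ((1 + \<bar>r\<bar>) / c)..(1 + \<bar>r\<bar>) / c}" if "c * (1 + \<bar>s\<bar>) \<le> 1 + \<bar>r\<bar>"
      proof -
        have "\<bar>s\<bar> \<le> (1 + \<bar>r\<bar>) / c"
          using that \<open>c > 0\<close> by (simp add: field_simps)
        then show ?thesis by auto
      qed
      then show "?F s r \<le> (G r * ennreal (1 / (1 + \<bar>r\<bar>))) * indicator {- ((1 + \<bar>r\<bar>) / c)..(1 + \<bar>r\<bar>) / c} s"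
        by (auto simp: indicator_def)
    qed
    also have "\<dots> = (G r * ennreal (1 / (1 + \<bar>r\<bar>))) * ennreal (2 * ((1 + \<bar>r\<bar>) / c))"
      using \<open>c > 0\<close> by (simp add: nn_integral_cmult_indicator)
    also have "\<dots> = G r * ennreal ((1 / (1 + \<bar>r\<bar>)) * (2 * ((1 + \<bar>r\<bar>) / c)))"
      using \<open>c > 0\<close> by (subst ennreal_mult) (auto simp: mult.assoc)
    also have "(1 / (1 + \<bar>r\<bar>)) * (2 * ((1 + \<bar>r\<bar>) / c)) = 2 / c"
    proof -
      have "(1 / p) * (2 * (p / c)) = 2 / c" if "p \<noteq> 0" for p :: real
        using that by (simp add: field_simps)
      from this[OF one_plus_abs(2)] show ?thesis .
    qed
    finally show "(\<integral>\<^sup>+ s. ?F s r \<partial>lborel) \<le> ennreal (2 / c) * G r"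
      by (simp add: mult.commute)
  qed
  also have "\<dots> = ennreal (2 / c) * (\<integral>\<^sup>+ r. G r \<partial>lborel)"
    by (rule nn_integral_cmult) measurable
  finally show ?thesis .
qed

text \<open>With \<open>1 + \<bar>y\<bar>\<close> in place of \<open>\<bar>y\<bar>\<close>, a
  bounded translation of \<open>y\<close> costs only a constant factor in the argument of
  \<open>e\<close>, just as a dilation does. Integrability for every \<open>c\<close> absorbs such
  factors.\<close>

definition radially_dominated :: "(real \<Rightarrow> complex) \<Rightarrow> bool" where
  "radially_dominated f \<longleftrightarrow> (\<exists>e. e \<in> borel_measurable borel \<and> antimono e \<and>
     (\<forall>y. ennreal (cmod (f y)) \<le> e (1 + \<bar>y\<bar>)) \<and>
     (\<forall>c>0. (\<integral>\<^sup>+ s. e (c * (1 + \<bar>s\<bar>)) \<partial>lborel) < \<infinity>))"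

lemma radially_dominated_envelope:
  assumes [measurable]: "G \<in> borel_measurable borel" and fin: "(\<integral>\<^sup>+ r. G r \<partial>lborel) < \<infinity>"
    and "q > 0" and le: "\<And>y. ennreal (cmod (f y)) \<le> ennreal C * envelope G (q * (1 + \<bar>y\<bar>))"
  shows "radially_dominated f"
  unfolding radially_dominated_def
proof (intro exI conjI allI impI)
  show "(\<lambda>x. ennreal C * envelope G (q * x)) \<in> borel_measurable borel" by measurable
  show "antimono (\<lambda>x. ennreal C * envelope G (q * x))"
    using \<open>q > 0\<close> by (intro antimonoI mult_left_mono antimonoD[OF antimono_envelope]) auto
  show "ennreal (cmod (f y)) \<le> ennreal C * envelope G (q * (1 + \<bar>y\<bar>))" for y by (rule le)
  fix c :: real assume "c > 0"
  have "(\<integral>\<^sup>+ s. ennreal C * envelope G (q * (c * (1 + \<bar>s\<bar>))) \<partial>lborel)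
      = ennreal C * (\<integral>\<^sup>+ s. envelope G ((q * c) * (1 + \<bar>s\<bar>)) \<partial>lborel)"
    by (subst nn_integral_cmult) (simp_all add: mult.assoc)
  also have "\<dots> \<le> ennreal C * (ennreal (2 / (q * c)) * (\<integral>\<^sup>+ r. G r \<partial>lborel))"
    using \<open>c > 0\<close> \<open>q > 0\<close> by (intro mult_left_mono nn_integral_envelope_le) auto
  also have "\<dots> < \<infinity>" using fin by (simp add: ennreal_mult_less_top)
  finally show "(\<integral>\<^sup>+ s. ennreal C * envelope G (q * (c * (1 + \<bar>s\<bar>))) \<partial>lborel) < \<infinity>" .
qed

text \<open>The inequality \<open>c * (1 + \<bar>s\<bar>) \<le> 1 + \<bar>\<tau> * s +
  \<delta>\<bar>\<close> holds on all of \<open>U\<close> when \<open>c\<close> is the minimum of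
  \<open>min 1 \<bar>\<tau>\<bar> / (1 + \<bar>\<delta>\<bar>)\<close>. This minimum is attained by
  compactness and positive because \<open>\<tau> \<noteq> 0\<close> on \<open>aff\<close>;
  monotonicity of \<open>e\<close> then removes the dependence on the group element.\<close>

lemma radially_dominated_uniform_affine:
  assumes f: "radially_dominated f" and U: "compact U" "U \<subseteq> aff"
  obtains h where "h \<in> borel_measurable borel" "(\<integral>\<^sup>+ s. h s \<partial>lborel) < \<infinity>"
    "\<And>\<delta> \<tau> s. (\<delta>, \<tau>) \<in> U \<Longrightarrow> ennreal (cmod (f (\<tau> * s + \<delta>))) \<le> h s"
proof -
  obtain e where e [measurable]: "e \<in> borel_measurable borel" and anti: "antimono e"
    and le: "\<And>y. ennreal (cmod (f y)) \<le> e (1 + \<bar>y\<bar>)"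
    and fin: "\<And>c. c > 0 \<Longrightarrow> (\<integral>\<^sup>+ s. e (c * (1 + \<bar>s\<bar>)) \<partial>lborel) < \<infinity>"
    using f unfolding radially_dominated_def by blast
  let ?m = "\<lambda>u::real \<times> real. min 1 \<bar>snd u\<bar> / (1 + \<bar>fst u\<bar>)"
  have "\<exists>c>0. \<forall>u\<in>U. c \<le> ?m u"
  proof (cases "U = {}")
    case True
    then show ?thesis by (auto intro: exI[of _ 1])
  next
    case False
    have "continuous_on U ?m"
      by (intro continuous_intros) simp
    from continuous_attains_inf[OF U(1) False this]
    obtain v where v: "v \<in> U" "\<And>u. u \<in> U \<Longrightarrow> ?m v \<le> ?m u" by blast
    moreover have "?m v > 0" using v(1) U(2) by (auto simp: aff_def intro!: divide_pos_pos)
    ultimately show ?thesis by blast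
  qed
  then obtain c where c: "c > 0" "\<And>u. u \<in> U \<Longrightarrow> c \<le> ?m u" by blast
  show ?thesis
  proof
    show "(\<lambda>s. e (c * (1 + \<bar>s\<bar>))) \<in> borel_measurable borel" by measurable
    show "(\<integral>\<^sup>+ s. e (c * (1 + \<bar>s\<bar>)) \<partial>lborel) < \<infinity>" by (rule fin[OF c(1)])
    fix \<delta> \<tau> s :: real
    assume "(\<delta>, \<tau>) \<in> U"
    then have "c \<le> min 1 \<bar>\<tau>\<bar> / (1 + \<bar>\<delta>\<bar>)" using c(2) by fastforce
    then have "c * (1 + \<bar>s\<bar>) \<le> min 1 \<bar>\<tau>\<bar> / (1 + \<bar>\<delta>\<bar>) * (1 + \<bar>s\<bar>)"
      by (intro mult_right_mono) auto
    also have "\<dots> \<le> 1 + \<bar>\<tau> * s + \<delta>\<bar>"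
    proof -
      have "min 1 \<bar>\<tau>\<bar> * \<bar>s\<bar> \<le> \<bar>\<tau> * s\<bar>" by (simp add: abs_mult mult_right_mono)
      then have "min 1 \<bar>\<tau>\<bar> * (1 + \<bar>s\<bar>) \<le> 1 + \<bar>\<tau> * s\<bar>"
        using min.cobounded1[of 1 "\<bar>\<tau>\<bar>"] unfolding distrib_left mult_1_right by linarith
      also have "\<dots> \<le> 1 + \<bar>\<tau> * s + \<delta>\<bar> + \<bar>\<delta>\<bar>" by linarith
      also have "\<dots> \<le> (1 + \<bar>\<tau> * s + \<delta>\<bar>) * (1 + \<bar>\<delta>\<bar>)" by (simp add: algebra_simps)
      finally show ?thesis by (simp add: divide_le_eq)
    qed
    finally have "e (1 + \<bar>\<tau> * s + \<delta>\<bar>) \<le> e (c * (1 + \<bar>s\<bar>))" by (rule antimonoD[OF anti])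
    with le show "ennreal (cmod (f (\<tau> * s + \<delta>))) \<le> e (c * (1 + \<bar>s\<bar>))"
      by (rule order_trans)
  qed
qed

text \<open>The tail integral of \<open>cmod (f r)\<close> is exactly the envelope of
  \<open>(1 + \<bar>r\<bar>) * cmod (f r)\<close>, which is integrable because the absolute moments
  of orders 0 and 1 converge.\<close>

lemma radially_dominated_antideriv:
  assumes v: "vanishing_moments (Suc n) f"
  shows "radially_dominated (antideriv f)"
proof (rule radially_dominated_envelope)
  let ?G = "\<lambda>r. ennreal ((1 + \<bar>r\<bar>) * cmod (f r))"
  have i0: "integrable lborel (\<lambda>t. cmod (f t))"
    using vanishing_moments_integrable[OF v] by simp
  have "integrable lborel (\<lambda>t. cmod (of_real (t ^ 1) * f t))"
    using v by (intro integrable_norm) (auto simp: vanishing_moments_def dest: spec[of _ 1])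
  then have i1: "integrable lborel (\<lambda>t. \<bar>t\<bar> * cmod (f t))" by (simp add: norm_mult)
  have [measurable]: "f \<in> borel_measurable borel"
    using vanishing_moments_integrable[OF v] by simp
  show "?G \<in> borel_measurable borel" by measurable
  have "integrable lborel (\<lambda>t. (1 + \<bar>t\<bar>) * cmod (f t))"
    using Bochner_Integration.integrable_add[OF i0 i1] by (simp add: distrib_right)
  then show "(\<integral>\<^sup>+ r. ?G r \<partial>lborel) < \<infinity>" by (simp add: integrable_iff_bounded)
  show "(0::real) < 1" by simp
  fix y
  have "ennreal (cmod (antideriv f y)) \<le> (\<integral>\<^sup>+ r. indicator {r. \<bar>y\<bar> \<le> \<bar>r\<bar>} r * ennreal (cmod (f r)) \<partial>lborel)"
    by (rule vanishing_moments_antideriv(3)[OF v])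
  also have "\<dots> = envelope ?G (1 * (1 + \<bar>y\<bar>))"
    unfolding envelope_def
  proof (intro nn_integral_cong)
    fix r :: real
    have "?G r * ennreal (1 / (1 + \<bar>r\<bar>)) = ennreal ((1 + \<bar>r\<bar>) * cmod (f r) * (1 / (1 + \<bar>r\<bar>)))"
      by (rule ennreal_mult[symmetric]) auto
    also have "(1 + \<bar>r\<bar>) * cmod (f r) * (1 / (1 + \<bar>r\<bar>)) = cmod (f r)"
      by simp
    finally show "indicator {r. \<bar>y\<bar> \<le> \<bar>r\<bar>} r * ennreal (cmod (f r)) =
       indicator {r. 1 * (1 + \<bar>y\<bar>) \<le> 1 + \<bar>r\<bar>} r * (?G r * ennreal (1 / (1 + \<bar>r\<bar>)))"
      by (simp add: indicator_def)
  qed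
  finally show "ennreal (cmod (antideriv f y)) \<le> ennreal 1 * envelope ?G (1 * (1 + \<bar>y\<bar>))" by simp
qed

lemma box_in_nbhd_of_neutral:
  assumes "(0, 1) \<in> interior U"
  obtains \<epsilon> :: real where "\<epsilon> > 0" "\<epsilon> < 1" "\<And>\<delta> \<tau>. \<bar>\<delta>\<bar> < \<epsilon> \<Longrightarrow> \<bar>\<tau> - 1\<bar> < \<epsilon> \<Longrightarrow> (\<delta>, \<tau>) \<in> (U :: (real \<times> real) set)"
proof -
  obtain r where r: "r > 0" "ball (0, 1) r \<subseteq> U"
    using assms by (auto simp: mem_interior)
  show ?thesis
  proof
    show "min (r / 2) (1 / 2) > 0" "min (r / 2) (1 / 2) < (1::real)" using r by auto
    fix \<delta> \<tau> :: real
    assume a: "\<bar>\<delta>\<bar> < min (r / 2) (1 / 2)" "\<bar>\<tau> - 1\<bar> < min (r / 2) (1 / 2)"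
    have "dist (0, 1) (\<delta>, \<tau>) \<le> \<bar>\<delta>\<bar> + \<bar>\<tau> - 1\<bar>"
      unfolding dist_prod_def using sqrt_sum_squares_le_sum_abs[of "\<bar>\<delta>\<bar>" "\<bar>1 - \<tau>\<bar>"]
      by (simp add: dist_real_def abs_minus_commute)
    also have "\<dots> < r" using a by linarith
    finally show "(\<delta>, \<tau>) \<in> U" using r(2) by auto
  qed
qed

text \<open>For \<open>u\<close> in a small box around \<open>(0, 1)\<close> the points \<open>\<tau> s + \<delta>\<close> fill an interval of length
  comparable to \<open>1 + \<bar>s\<bar>\<close> around \<open>s\<close>. The supremum \<open>G\<close> over that open interval is lower
  semicontinuous, unlike the supremum over \<open>U\<close>, which need not be Borel measurable; averaging
  \<open>G\<close> over the interval around \<open>y\<close> bounds \<open>\<bar>g y\<bar>\<close> by an envelope.\<close>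

lemma radially_dominated_of_sup_integrable:
  fixes g :: "real \<Rightarrow> complex"
  assumes U: "(0, 1) \<in> interior U"
    and fin: "(\<integral>\<^sup>+ t. (SUP (\<delta>, \<tau>)\<in>U. ennreal (cmod (g (\<tau> * t + \<delta>)))) \<partial>lborel) < \<infinity>"
  shows "radially_dominated g"
proof -
  obtain \<epsilon> where eps: "\<epsilon> > 0" "\<epsilon> < 1"
    and box: "\<And>\<delta> \<tau>. \<bar>\<delta>\<bar> < \<epsilon> \<Longrightarrow> \<bar>\<tau> - 1\<bar> < \<epsilon> \<Longrightarrow> (\<delta>, \<tau>) \<in> U"
    using box_in_nbhd_of_neutral[OF U] by blast
  define G where "G s = (SUP y\<in>{y. \<bar>y - s\<bar> < \<epsilon> * (1 + \<bar>s\<bar>)}. ennreal (cmod (g y)))" for s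
  have G_meas [measurable]: "G \<in> borel_measurable borel"
  proof (rule borel_measurableI_greater)
    fix c :: ennreal
    have "{s \<in> space borel. c < G s} = (\<Union>y\<in>{y. c < ennreal (cmod (g y))}. {s. \<bar>y - s\<bar> < \<epsilon> * (1 + \<bar>s\<bar>)})"
      by (auto simp: G_def less_SUP_iff)
    also have "open \<dots>"
      by (intro open_UN ballI open_Collect_less continuous_intros)
    finally show "{s \<in> space borel. c < G s} \<in> sets borel" by simp
  qed
  have G_le: "G s \<le> (SUP (\<delta>, \<tau>)\<in>U. ennreal (cmod (g (\<tau> * s + \<delta>))))" for s
    unfolding G_def
  proof (rule SUP_least)
    fix y assume "y \<in> {y. \<bar>y - s\<bar> < \<epsilon> * (1 + \<bar>s\<bar>)}"
    then have y: "\<bar>(y - s) / (1 + \<bar>s\<bar>)\<bar> < \<epsilon>"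
      by (simp add: abs_divide pos_divide_less_eq)
    \<comment> \<open>To reach \<open>y\<close> from \<open>s\<close>, translation and dilation push
      in the same direction: with \<open>\<tau> - 1 = sgn s * \<delta>\<close> the total
      displacement is \<open>\<delta> * (1 + \<bar>s\<bar>)\<close>.\<close>
    define \<delta> where "\<delta> = (y - s) / (1 + \<bar>s\<bar>)"
    define \<tau> where "\<tau> = 1 + sgn s * \<delta>"
    have "\<tau> * s + \<delta> = s + \<delta> * (1 + \<bar>s\<bar>)"
      by (simp add: \<tau>_def abs_sgn algebra_simps)
    also have "\<delta> * (1 + \<bar>s\<bar>) = y - s" by (simp add: \<delta>_def)
    finally have eq: "\<tau> * s + \<delta> = y" by simp
    have "\<bar>\<delta>\<bar> < \<epsilon>" using y by (simp add: \<delta>_def)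
    moreover from this have "\<bar>\<tau> - 1\<bar> < \<epsilon>"
      by (auto simp: \<tau>_def abs_mult sgn_if)
    ultimately have "(\<delta>, \<tau>) \<in> U" by (rule box)
    from SUP_upper[OF this, of "\<lambda>(\<delta>, \<tau>). ennreal (cmod (g (\<tau> * s + \<delta>)))"]
    show "ennreal (cmod (g y)) \<le> (SUP (\<delta>, \<tau>)\<in>U. ennreal (cmod (g (\<tau> * s + \<delta>))))"
      by (simp add: eq)
  qed
  \<comment> \<open>This solves \<open>\<kappa> = \<epsilon> * (1 - \<kappa>)\<close>, so that
    \<open>\<bar>y - s\<bar> < \<kappa> * (1 + \<bar>y\<bar>)\<close> implies
    \<open>\<bar>y - s\<bar> < \<epsilon> * (1 + \<bar>s\<bar>)\<close>. It converts an interval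
    scaled by its centre \<open>y\<close> into one scaled by \<open>s\<close>.\<close>
  define \<kappa> where "\<kappa> = \<epsilon> / (1 + \<epsilon>)"
  have kap: "\<kappa> > 0" "\<kappa> < 1" "\<kappa> = \<epsilon> * (1 - \<kappa>)"
    using eps by (auto simp: \<kappa>_def field_simps)
  show ?thesis
  proof (rule radially_dominated_envelope)
    show "G \<in> borel_measurable borel" by (rule G_meas)
    have "(\<integral>\<^sup>+ r. G r \<partial>lborel) \<le> (\<integral>\<^sup>+ t. (SUP (\<delta>, \<tau>)\<in>U. ennreal (cmod (g (\<tau> * t + \<delta>)))) \<partial>lborel)"
      by (intro nn_integral_mono G_le)
    then show "(\<integral>\<^sup>+ r. G r \<partial>lborel) < \<infinity>" using fin by (rule le_less_trans)
    show "1 - \<kappa> > 0" using kap by simp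
    fix y :: real
    define R where "R = \<kappa> * (1 + \<bar>y\<bar>)"
    have R: "R > 0" using kap by (simp add: R_def add_pos_nonneg)
    \<comment> \<open>On the interval of radius \<open>R\<close> about \<open>y\<close> the constant
      \<open>cmod (g y)\<close> is at most \<open>G s\<close>. There
      \<open>1 + \<bar>s\<bar>\<close> is comparable to \<open>1 + \<bar>y\<bar>\<close>, so a
      factor at least 1 can be inserted to produce the integrand of the envelope.\<close>
    have "ennreal (cmod (g y)) * ennreal (2 * R) = (\<integral>\<^sup>+ s. ennreal (cmod (g y)) * indicator {y - R<..<y + R} s \<partial>lborel)"
      using R by (simp add: nn_integral_cmult_indicator)
    also have "\<dots> \<le> (\<integral>\<^sup>+ r. ennreal ((1 + \<kappa>) * (1 + \<bar>y\<bar>)) *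
       (indicator {r. (1 - \<kappa>) * (1 + \<bar>y\<bar>) \<le> 1 + \<bar>r\<bar>} r * (G r * ennreal (1 / (1 + \<bar>r\<bar>)))) \<partial>lborel)"
    proof (intro nn_integral_mono)
      fix s :: real
      show "ennreal (cmod (g y)) * indicator {y - R<..<y + R} s \<le> ennreal ((1 + \<kappa>) * (1 + \<bar>y\<bar>)) *
       (indicator {r. (1 - \<kappa>) * (1 + \<bar>y\<bar>) \<le> 1 + \<bar>r\<bar>} s * (G s * ennreal (1 / (1 + \<bar>s\<bar>))))"
      proof (cases "s \<in> {y - R<..<y + R}")
        case True
        then have ys: "\<bar>y - s\<bar> < \<kappa> * (1 + \<bar>y\<bar>)" by (auto simp: R_def)
        then have lo: "(1 - \<kappa>) * (1 + \<bar>y\<bar>) \<le> 1 + \<bar>s\<bar>" and hi: "1 + \<bar>s\<bar> \<le> (1 + \<kappa>) * (1 + \<bar>y\<bar>)"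
          unfolding distrib_right left_diff_distrib mult_1 by linarith+
        have "\<kappa> * (1 + \<bar>y\<bar>) = \<epsilon> * ((1 - \<kappa>) * (1 + \<bar>y\<bar>))" by (subst kap(3)) simp
        also have "\<dots> \<le> \<epsilon> * (1 + \<bar>s\<bar>)" using lo eps by simp
        finally have "ennreal (cmod (g y)) \<le> G s"
          unfolding G_def using ys by (intro SUP_upper) auto
        also have "G s = 1 * G s" by simp
        also have "\<dots> \<le> ennreal ((1 + \<kappa>) * (1 + \<bar>y\<bar>) * (1 / (1 + \<bar>s\<bar>))) * G s"
          using hi by (intro mult_right_mono) (simp_all add: le_divide_eq)
        also have "\<dots> = ennreal ((1 + \<kappa>) * (1 + \<bar>y\<bar>)) * (G s * ennreal (1 / (1 + \<bar>s\<bar>)))"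
          using kap by (subst ennreal_mult) (auto simp: ac_simps)
        finally show ?thesis using True lo by simp
      qed simp
    qed
    also have "\<dots> = ennreal ((1 + \<kappa>) * (1 + \<bar>y\<bar>)) * envelope G ((1 - \<kappa>) * (1 + \<bar>y\<bar>))"
      unfolding envelope_def by (rule nn_integral_cmult) (unfold indicator_def mem_Collect_eq of_bool_def, measurable)
    finally have *: "ennreal (cmod (g y)) * ennreal (2 * R) \<le> ennreal ((1 + \<kappa>) * (1 + \<bar>y\<bar>)) * envelope G ((1 - \<kappa>) * (1 + \<bar>y\<bar>))" .
    \<comment> \<open>Division by the length \<open>2 * R\<close> cancels
      \<open>1 + \<bar>y\<bar>\<close> and leaves a constant independent of
      \<open>y\<close>.\<close>
    have "ennreal (cmod (g y)) = ennreal (cmod (g y)) * ennreal (2 * R) * ennreal (1 / (2 * R))"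
      using R by (simp add: ennreal_mult[symmetric])
    also have "\<dots> \<le> ennreal ((1 + \<kappa>) * (1 + \<bar>y\<bar>)) * envelope G ((1 - \<kappa>) * (1 + \<bar>y\<bar>)) * ennreal (1 / (2 * R))"
      by (rule mult_right_mono[OF *]) simp
    also have "\<dots> = ennreal ((1 + \<kappa>) * (1 + \<bar>y\<bar>) * (1 / (2 * R))) * envelope G ((1 - \<kappa>) * (1 + \<bar>y\<bar>))"
      using R kap by (subst ennreal_mult) (auto simp: ac_simps)
    also have "(1 + \<kappa>) * (1 + \<bar>y\<bar>) * (1 / (2 * R)) = (1 + \<kappa>) / (2 * \<kappa>)"
      using R kap by (simp add: R_def field_simps)
    finally show "ennreal (cmod (g y)) \<le> ennreal ((1 + \<kappa>) / (2 * \<kappa>)) * envelope G ((1 - \<kappa>) * (1 + \<bar>y\<bar>))" .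
  qed
qed

section \<open>The affine group\<close>

lemma aff_borel [measurable]: "aff \<in> sets borel"
  unfolding aff_def by (intro borel_open open_Times) auto

lemma space_aff_haar [simp]: "space aff_haar = aff"
  by (simp add: aff_haar_def space_restrict_space)

lemma aff_haar_measurable_of_borel:
  "f \<in> borel_measurable borel \<Longrightarrow> f \<in> borel_measurable aff_haar"
  unfolding aff_haar_def measurable_density_eq1
  by (intro measurable_restrict_space1 measurable_completion) simp

text \<open>In \<open>measurable_osc\<close> this makes the measure of a section a measurable
  function of the base point.\<close>

lemma sigma_finite_aff_haar: "sigma_finite_measure aff_haar"
proof -
  have "sigma_finite_measure (lebesgue :: (real \<times> real) measure)"
  proof
    obtain A :: "(real \<times> real) set set" where "countable A" "A \<subseteq> sets lborel" "\<Union>A = space lborel" "\<forall>a\<in>A. emeasure lborel a \<noteq> \<infinity>"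
      using lborel.sigma_finite_countable by blast
    then show "\<exists>A. countable A \<and> A \<subseteq> sets (lebesgue :: (real \<times> real) measure) \<and> \<Union>A = space lebesgue \<and> (\<forall>a\<in>A. emeasure lebesgue a \<noteq> \<infinity>)"
      by (intro exI[of _ A]) (auto simp: subset_iff)
  qed
  then interpret sigma_finite_measure "restrict_space lebesgue aff"
    by (rule sigma_finite_measure_restrict_space) (simp add: sets_completionI_sets)
  have "(\<lambda>(b::real, a::real). ennreal (1 / a\<^sup>2)) \<in> borel_measurable borel"
    unfolding borel_prod[symmetric] by measurable
  then have "(\<lambda>(b, a). ennreal (1 / a\<^sup>2)) \<in> borel_measurable (restrict_space lebesgue aff)"
    by (intro measurable_restrict_space1 measurable_completion) simp
  then show ?thesis
    unfolding aff_haar_def by (subst sigma_finite_iff_density_finite) auto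
qed

lemma nn_integral_aff_haar:
  assumes f: "f \<in> borel_measurable borel"
  shows "(\<integral>\<^sup>+ x. f x \<partial>aff_haar) = (\<integral>\<^sup>+ a. \<integral>\<^sup>+ b. f (b, a) * ennreal (1 / a\<^sup>2) \<partial>lborel \<partial>lborel)"
proof -
  have w: "(\<lambda>(b::real, a::real). ennreal (1 / a\<^sup>2)) \<in> borel_measurable borel"
    unfolding borel_prod[symmetric] by measurable
  have g: "(\<lambda>(b, a). f (b, a) * ennreal (1 / a\<^sup>2)) \<in> borel_measurable (lborel \<Otimes>\<^sub>M lborel)"
    using f by (simp add: borel_prod[symmetric] lborel_prod cong: measurable_cong_sets)
  have "(\<integral>\<^sup>+ x. f x \<partial>aff_haar)
      = (\<integral>\<^sup>+ x. (case x of (b, a) \<Rightarrow> ennreal (1 / a\<^sup>2)) * f x \<partial>restrict_space lebesgue aff)"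
    unfolding aff_haar_def
    by (intro nn_integral_density measurable_restrict_space1 measurable_completion) (use f w in simp_all)
  also have "\<dots> = (\<integral>\<^sup>+ x. (case x of (b, a) \<Rightarrow> ennreal (1 / a\<^sup>2)) * f x * indicator aff x \<partial>lebesgue)"
    by (rule nn_integral_restrict_space) (simp add: sets_completionI_sets)
  also have "\<dots> = (\<integral>\<^sup>+ x. (case x of (b, a) \<Rightarrow> f (b, a) * ennreal (1 / a\<^sup>2)) \<partial>(lborel \<Otimes>\<^sub>M lborel))"
    unfolding nn_integral_completion lborel_prod
    by (intro nn_integral_cong) (auto simp: aff_def indicator_def mult.commute)
  also have "\<dots> = (\<integral>\<^sup>+ a. \<integral>\<^sup>+ b. f (b, a) * ennreal (1 / a\<^sup>2) \<partial>lborel \<partial>lborel)"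
    using lborel_pair.nn_integral_snd[OF g] by simp
  finally show ?thesis .
qed

section \<open>Integrals of powers of the dilation parameter\<close>

lemma nn_integral_even_finite:
  fixes f :: "real \<Rightarrow> ennreal"
  assumes [measurable]: "f \<in> borel_measurable borel" and even: "\<And>a. f (- a) = f a"
    and fin: "(\<integral>\<^sup>+ a. indicator {0..} a * f a \<partial>lborel) < \<infinity>"
  shows "(\<integral>\<^sup>+ a. f a \<partial>lborel) < \<infinity>"
proof -
  have "(\<integral>\<^sup>+ a. f a \<partial>lborel) \<le> (\<integral>\<^sup>+ a. indicator {0..} a * f a + indicator {0..} (- a) * f (- a) \<partial>lborel)"
    by (intro nn_integral_mono) (auto simp: indicator_def even)
  also have "\<dots> = (\<integral>\<^sup>+ a. indicator {0..} a * f a \<partial>lborel) + (\<integral>\<^sup>+ a. indicator {0..} (- a) * f (- a) \<partial>lborel)"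
    by (rule nn_integral_add) measurable
  also have "(\<integral>\<^sup>+ a. indicator {0..} (- a) * f (- a) \<partial>lborel) = (\<integral>\<^sup>+ a. indicator {0..} a * f a \<partial>lborel)"
    using nn_integral_real_affine[of "\<lambda>a. indicator {0..} a * f a" "-1" 0] by simp
  finally show ?thesis by (rule le_less_trans) (use fin in simp)
qed

lemma nn_integral_powr_near_0:
  fixes p :: real assumes "p > - 1"
  shows "(\<integral>\<^sup>+ a. indicator {- 1..1} a * ennreal (\<bar>a\<bar> powr p) \<partial>lborel) < \<infinity>"
proof (rule nn_integral_even_finite)
  show "(\<lambda>a. indicator {- 1..1} a * ennreal (\<bar>a\<bar> powr p)) \<in> borel_measurable borel" by measurable
  have "(\<integral>\<^sup>+ a. indicator {0..} a * (indicator {- 1..1} a * ennreal (\<bar>a\<bar> powr p)) \<partial>lborel)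
      = (\<integral>\<^sup>+ a. ennreal (indicator {0..1} a * a powr p) \<partial>lborel)"
    by (intro nn_integral_cong) (auto simp: indicator_def)
  also have "\<dots> = ennreal (1 powr (p + 1) / (p + 1))"
    by (intro nn_integral_has_integral_lebesgue has_integral_powr_from_0) (use assms in auto)
  finally show "(\<integral>\<^sup>+ a. indicator {0..} a * (indicator {- 1..1} a * ennreal (\<bar>a\<bar> powr p)) \<partial>lborel) < \<infinity>" by simp
qed (auto simp: indicator_def)

lemma nn_integral_powr_near_infinity:
  fixes q :: real assumes "q < - 1"
  shows "(\<integral>\<^sup>+ a. indicator {a. 1 \<le> \<bar>a\<bar>} a * ennreal (\<bar>a\<bar> powr q) \<partial>lborel) < \<infinity>"
proof (rule nn_integral_even_finite)
  show "(\<lambda>a. indicator {a. 1 \<le> \<bar>a\<bar>} a * ennreal (\<bar>a\<bar> powr q)) \<in> borel_measurable borel" by measurable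
  have "(\<integral>\<^sup>+ a. indicator {0..} a * (indicator {a. 1 \<le> \<bar>a\<bar>} a * ennreal (\<bar>a\<bar> powr q)) \<partial>lborel)
      = (\<integral>\<^sup>+ a. ennreal (indicator {1..} a * a powr q) \<partial>lborel)"
    by (intro nn_integral_cong) (auto simp: indicator_def)
  also have "\<dots> = ennreal (- (1 powr (q + 1)) / (q + 1))"
    by (intro nn_integral_has_integral_lebesgue has_integral_powr_to_inf) (use assms in auto)
  finally show "(\<integral>\<^sup>+ a. indicator {0..} a * (indicator {a. 1 \<le> \<bar>a\<bar>} a * ennreal (\<bar>a\<bar> powr q)) \<partial>lborel) < \<infinity>" by simp
qed (auto simp: indicator_def)

section \<open>Measurability of the oscillation\<close>

lemma aff_mult_in_aff: "x \<in> aff \<Longrightarrow> y \<in> aff \<Longrightarrow> aff_mult x y \<in> aff"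
  by (auto simp: aff_def aff_mult_def)

context
  fixes F :: "real \<times> real \<Rightarrow> complex" and U :: "(real \<times> real) set"
  assumes F: "continuous_on aff F" and U: "compact U" "U \<subseteq> aff"
begin

lemma space_restrict_aff_haar: "space (restrict_space aff_haar U) = U"
  using U by (auto simp: space_restrict_space)

lemma measurable_aff_translate_diff:
  "(\<lambda>(x, u). ennreal (cmod (F (aff_mult u x) - F x)))
     \<in> borel_measurable (aff_haar \<Otimes>\<^sub>M restrict_space aff_haar U)"
proof -
  \<comment> \<open>Continuity of \<open>F\<close> gives control on \<open>aff\<close> only.
    Extended by zero it is Borel on the whole plane, and nothing changes at the points involved,
    since \<open>aff\<close> is closed under multiplication.\<close>
  define F0 where "F0 x = (if x \<in> aff then F x else 0)" for x
  have F0: "F0 \<in> borel_measurable borel"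
    unfolding F0_def by (rule borel_measurable_continuous_on_if) (use F in auto)
  have mult: "(\<lambda>(x, u). aff_mult u x) \<in> borel_measurable borel"
    by (intro borel_measurable_continuous_onI) (auto simp: aff_mult_def split_beta intro!: continuous_intros)
  have id1: "(\<lambda>x. x) \<in> aff_haar \<rightarrow>\<^sub>M borel"
    by (rule aff_haar_measurable_of_borel) simp
  have id2: "(\<lambda>x. x) \<in> restrict_space aff_haar U \<rightarrow>\<^sub>M borel"
    by (rule measurable_restrict_space1[OF id1])
  have "(\<lambda>(x, u). (x, u)) \<in> aff_haar \<Otimes>\<^sub>M restrict_space aff_haar U \<rightarrow>\<^sub>M borel \<Otimes>\<^sub>M borel"
    unfolding split_beta
    by (intro measurable_Pair measurable_compose[OF measurable_fst id1] measurable_compose[OF measurable_snd id2])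
  then have id: "(\<lambda>(x, u). (x, u)) \<in> aff_haar \<Otimes>\<^sub>M restrict_space aff_haar U \<rightarrow>\<^sub>M borel"
    unfolding borel_prod .
  have "(\<lambda>z. ennreal (cmod (F0 ((\<lambda>(x, u). aff_mult u x) z) - F0 (fst z)))) \<in> borel_measurable borel"
  proof -
    have "fst \<in> (borel :: ((real \<times> real) \<times> real \<times> real) measure) \<rightarrow>\<^sub>M borel"
      by (intro borel_measurable_continuous_onI continuous_intros)
    from measurable_compose[OF this F0] measurable_compose[OF mult F0]
    show ?thesis by simp
  qed
  from measurable_compose[OF id this]
  have "(\<lambda>(x, u). ennreal (cmod (F0 (aff_mult u x) - F0 x)))
     \<in> borel_measurable (aff_haar \<Otimes>\<^sub>M restrict_space aff_haar U)"
    by (simp add: split_beta)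
  then show ?thesis
    by (subst measurable_cong[where g="\<lambda>(x, u). ennreal (cmod (F0 (aff_mult u x) - F0 x))"])
      (use U in \<open>auto simp: space_pair_measure space_restrict_aff_haar F0_def aff_mult_in_aff subset_iff\<close>)
qed

text \<open>By definition \<open>esssup\<close> is \<open>top\<close> on functions that are not
  measurable, so this must be known before any upper bound for \<open>osc\<close>.\<close>

lemma measurable_aff_translate_diff_section:
  "x \<in> aff \<Longrightarrow> (\<lambda>u. ennreal (cmod (F (aff_mult u x) - F x))) \<in> borel_measurable (restrict_space aff_haar U)"
  using measurable_compose[OF measurable_Pair1' measurable_aff_translate_diff, of x] by simp

lemma osc_le:
  assumes "x \<in> aff" and "\<And>u. u \<in> U \<Longrightarrow> ennreal (cmod (F (aff_mult u x) - F x)) \<le> c"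
  shows "osc U F x \<le> c"
  unfolding osc_def
  by (rule esssup_I) (use assms measurable_aff_translate_diff_section in \<open>auto simp: space_restrict_aff_haar intro!: AE_I2\<close>)

text \<open>The essential supremum at \<open>x\<close> exceeds \<open>c\<close> exactly when the
  section of \<open>?Q\<close> at \<open>x\<close> has nonzero measure, and by sigma-finiteness that
  measure depends measurably on \<open>x\<close>.\<close>

lemma measurable_osc: "osc U F \<in> borel_measurable aff_haar"
proof (rule borel_measurableI_greater)
  fix c :: ennreal
  let ?M = "restrict_space aff_haar U" and ?f = "\<lambda>x u. ennreal (cmod (F (aff_mult u x) - F x))"
  let ?Q = "{z \<in> space (aff_haar \<Otimes>\<^sub>M ?M). c < (case z of (x, u) \<Rightarrow> ?f x u)}"
  have "U \<in> sets aff_haar"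
  proof -
    have "U = U \<inter> aff" using U by auto
    also have "\<dots> \<in> sets (restrict_space lebesgue aff)"
      using U(1) by (intro sets_restrict_space_iff[THEN iffD2])
        (auto simp: sets_completionI_sets compact_imp_closed)
    finally show ?thesis by (simp add: aff_haar_def)
  qed
  with sigma_finite_aff_haar interpret sigma_finite_measure ?M
    by (rule sigma_finite_measure_restrict_space)
  have "?Q \<in> sets (aff_haar \<Otimes>\<^sub>M ?M)"
    using measurable_aff_translate_diff by measurable
  then have meas: "(\<lambda>x. emeasure ?M (Pair x -` ?Q)) \<in> borel_measurable aff_haar"
    by (rule measurable_emeasure_Pair)
  have "c < osc U F x \<longleftrightarrow> emeasure ?M (Pair x -` ?Q) \<noteq> 0" if x: "x \<in> aff" for x
  proof -
    note m = measurable_aff_translate_diff_section[OF x]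
    have sec: "Pair x -` ?Q = {u \<in> space ?M. \<not> ?f x u \<le> c}"
      using x by (auto simp: space_pair_measure not_le)
    have "emeasure ?M (Pair x -` ?Q) = 0 \<longleftrightarrow> (AE u in ?M. ?f x u \<le> c)"
    proof -
      have "{u \<in> space ?M. \<not> g u \<le> c} \<in> sets ?M" if "g \<in> borel_measurable ?M" for g :: "_ \<Rightarrow> ennreal"
        using that by measurable
      from AE_iff_measurable[OF this[OF m] refl] show ?thesis unfolding sec by simp
    qed
    also have "\<dots> \<longleftrightarrow> osc U F x \<le> c"
    proof
      assume "AE u in ?M. ?f x u \<le> c"
      with m show "osc U F x \<le> c" unfolding osc_def by (rule esssup_I)
    next
      assume "osc U F x \<le> c"
      with esssup_AE[of "?f x" "?M"] show "AE u in ?M. ?f x u \<le> c"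
        unfolding osc_def by (auto elim!: eventually_mono)
    qed
    finally show ?thesis by auto
  qed
  then have "{x \<in> space aff_haar. c < osc U F x} = {x \<in> space aff_haar. emeasure ?M (Pair x -` ?Q) \<noteq> 0}"
    by auto
  also have "\<dots> \<in> sets aff_haar" using meas by measurable
  finally show "{x \<in> space aff_haar. c < osc U F x} \<in> sets aff_haar" .
qed

end

section \<open>The wavelet transform\<close>

lemma borel_measurable_cnj [measurable]: "cnj \<in> borel_measurable borel"
  by (intro borel_measurable_continuous_onI continuous_intros)

lemma has_vector_derivative_affine:
  fixes f :: "real \<Rightarrow> complex"
  assumes "(f has_vector_derivative f') (at (\<alpha> * t + \<beta>))"
  shows "((\<lambda>t. f (\<alpha> * t + \<beta>)) has_vector_derivative \<alpha> *\<^sub>R f') (at t)"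
proof -
  have "((\<lambda>t. \<alpha> * t + \<beta>) has_vector_derivative \<alpha>) (at t)"
    by (auto simp: has_real_derivative_iff_has_vector_derivative[symmetric] intro!: derivative_eq_intros)
  from vector_diff_chain_at[OF this assms] show ?thesis by (simp add: o_def)
qed

lemma integrable_affine:
  fixes f :: "real \<Rightarrow> complex"
  assumes "integrable lborel f" "\<alpha> \<noteq> 0"
  shows "integrable lborel (\<lambda>t. f (\<alpha> * t + \<beta>))"
  using lborel_integrable_real_affine[OF assms, of \<beta>] by (simp add: add.commute)

lemma ennreal_norm_integral_mult_cnj_le:
  fixes f g :: "real \<Rightarrow> complex"
  assumes "\<And>t. ennreal (cmod (f t)) \<le> F t" "\<And>t. ennreal (cmod (g t)) \<le> G t"
  shows "ennreal (cmod (LINT t|lborel. f t * cnj (g t))) \<le> (\<integral>\<^sup>+ t. F t * G t \<partial>lborel)"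
proof (cases "integrable lborel (\<lambda>t. f t * cnj (g t))")
  case True
  then have "ennreal (cmod (LINT t|lborel. f t * cnj (g t))) \<le> (\<integral>\<^sup>+ t. ennreal (cmod (f t * cnj (g t))) \<partial>lborel)"
    by (rule integral_norm_bound_ennreal)
  also have "\<dots> \<le> (\<integral>\<^sup>+ t. F t * G t \<partial>lborel)"
    using assms by (intro nn_integral_mono) (simp add: norm_mult ennreal_mult mult_mono)
  finally show ?thesis .
\<comment> \<open>A product that is not integrable has Bochner integral 0 by convention.\<close>
qed (simp add: not_integrable_integral_eq)

text \<open>The supremum condition enters only as \<open>d_dominated\<close>, which no longer
  mentions a neighbourhood; the estimates then hold for any compact subset of
  \<open>aff\<close>.\<close>

locale smooth_wavelet =
  fixes L :: nat and \<psi> :: "real \<Rightarrow> complex" and d :: "nat \<Rightarrow> real \<Rightarrow> complex"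
  assumes L_pos: "L \<ge> 1"
    and moments: "vanishing_moments L \<psi>"
    and d_0: "d 0 = \<psi>"
    and d_deriv: "\<And>k t. k < L \<Longrightarrow> (d k has_vector_derivative d (Suc k) t) (at t)"
    and d_integrable: "\<And>k. k \<le> L \<Longrightarrow> integrable lborel (d k)"
    and d_dominated: "radially_dominated (d L)"
begin

text \<open>\<open>primitive L\<close> is the function \<Psi> of the overview.\<close>

definition primitive :: "nat \<Rightarrow> real \<Rightarrow> complex" where
  "primitive k = (antideriv ^^ k) \<psi>"

lemma primitive_moments: "k \<le> L \<Longrightarrow> vanishing_moments (L - k) (primitive k)"
  using vanishing_moments_iterated_antideriv[of k "L - k" \<psi>] moments by (simp add: primitive_def)

lemma primitive_integrable: "k \<le> L \<Longrightarrow> integrable lborel (primitive k)"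
  using primitive_moments vanishing_moments_integrable by blast

lemma primitive_deriv: "k < L \<Longrightarrow> (primitive (Suc k) has_vector_derivative primitive k t) (at t)"
  using vanishing_moments_antideriv(2)[of "L - Suc k" "primitive k"] primitive_moments[of k]
  by (simp add: primitive_def Suc_diff_Suc)

text \<open>The last antiderivative is applied to \<open>primitive (L - 1)\<close>, which still has
  one vanishing moment and an absolutely convergent first moment.\<close>

lemma primitive_dominated: "radially_dominated (primitive L)"
proof -
  have "vanishing_moments (Suc 0) (primitive (L - 1))"
    using primitive_moments[of "L - 1"] L_pos by simp
  from radially_dominated_antideriv[OF this] show ?thesis
    using L_pos by (cases L) (simp_all add: primitive_def)
qed

lemma borel_psi [measurable]: "\<psi> \<in> borel_measurable borel"
  and borel_dL [measurable]: "d L \<in> borel_measurable borel"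
  and borel_primitive [measurable]: "primitive L \<in> borel_measurable borel"
  using d_integrable[of 0] d_integrable[of L] primitive_integrable[of L] by (simp_all add: d_0)

text \<open>Each of the \<open>L\<close> integrations by parts gains \<open>\<alpha>'\<close> from differentiating one rescaled function and
  \<open>1 / \<alpha>\<close> from integrating the other.\<close>

lemma correlation_by_parts:
  assumes a: "\<alpha> \<noteq> 0" "\<alpha>' \<noteq> 0"
  shows "cmod (LINT t|lborel. \<psi> (\<alpha> * t + \<beta>) * cnj (\<psi> (\<alpha>' * t + \<beta>')))
    = (\<bar>\<alpha>'\<bar> / \<bar>\<alpha>\<bar>) ^ L * cmod (LINT t|lborel. primitive L (\<alpha> * t + \<beta>) * cnj (d L (\<alpha>' * t + \<beta>')))"
proof -
  define u where "u k t = (1 / \<alpha>) ^ k *\<^sub>R primitive k (\<alpha> * t + \<beta>)" for k t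
  define v where "v k t = \<alpha>' ^ k *\<^sub>R cnj (d k (\<alpha>' * t + \<beta>'))" for k t
  have "(LINT t|lborel. u 0 t * v 0 t) = (- 1) ^ L * (LINT t|lborel. u L t * v L t)"
  proof (rule iterated_integral_by_parts)
    fix k t assume "k < L"
    show "(u (Suc k) has_vector_derivative u k t) (at t)"
      using has_vector_derivative_scaleR[OF DERIV_const[of "(1 / \<alpha>) ^ Suc k"]
          has_vector_derivative_affine[OF primitive_deriv[OF \<open>k < L\<close>]], of \<alpha> \<beta> t] a
      unfolding u_def by simp
    show "(v k has_vector_derivative v (Suc k) t) (at t)"
      using has_vector_derivative_scaleR[OF DERIV_const[of "\<alpha>' ^ k"]
          has_vector_derivative_cnj[OF has_vector_derivative_affine[OF d_deriv[OF \<open>k < L\<close>]]], of \<alpha>' \<beta>' t]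
      unfolding v_def by (simp add: mult.commute)
  next
    fix k assume "k \<le> L"
    show "integrable lborel (u k)"
      unfolding u_def by (intro integrable_scaleR_right integrable_affine primitive_integrable a \<open>k \<le> L\<close>)
    show "integrable lborel (v k)"
      unfolding v_def by (intro integrable_scaleR_right complex_integrable_cnj[THEN iffD2] integrable_affine d_integrable a \<open>k \<le> L\<close>)
  qed
  also have "(LINT t|lborel. u L t * v L t)
      = ((1 / \<alpha>) ^ L * \<alpha>' ^ L) *\<^sub>R (LINT t|lborel. primitive L (\<alpha> * t + \<beta>) * cnj (d L (\<alpha>' * t + \<beta>')))"
    unfolding u_def v_def by (simp add: scaleR_conv_of_real algebra_simps flip: integral_mult_right_zero)
  also have "(LINT t|lborel. u 0 t * v 0 t) = (LINT t|lborel. \<psi> (\<alpha> * t + \<beta>) * cnj (\<psi> (\<alpha>' * t + \<beta>')))"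
    by (simp add: u_def v_def primitive_def d_0)
  finally show ?thesis
    by (simp add: norm_mult norm_power power_divide abs_mult power_abs divide_simps)
qed

section \<open>The wavelet transform after integration by parts\<close>

abbreviation W :: "real \<times> real \<Rightarrow> complex" where
  "W \<equiv> wavelet_transform \<psi> \<psi>"

lemma W_eq: "W (b, a) = of_real (\<bar>a\<bar> powr (- 1 / 2)) * (LINT t|lborel. \<psi> t * cnj (\<psi> ((t - b) / a)))"
proof -
  have "(\<lambda>t. \<psi> t * cnj (\<psi> ((t - b) / a))) \<in> borel_measurable lborel" by measurable
  then show ?thesis unfolding wavelet_transform_def by (simp add: integral_completion)
qed

text \<open>The substitution \<open>t = b + a * s\<close> and a conjugation leave
  \<open>\<psi>\<close> unscaled in the first factor, so integrating by parts yields
  \<open>\<bar>a\<bar> ^ L\<close>; the exponent is \<open>- 1 / 2 + 1 + L\<close>. At a translated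
  point the group element acts on \<open>d L\<close> only.\<close>

lemma norm_W_small_scale:
  assumes "a \<noteq> 0"
  shows "cmod (W (b, a)) = \<bar>a\<bar> powr (1 / 2 + L) * cmod (LINT t|lborel. primitive L t * cnj (d L (a * t + b)))"
proof -
  have "(LINT t|lborel. \<psi> t * cnj (\<psi> ((t - b) / a))) = \<bar>a\<bar> *\<^sub>R (LINT t|lborel. \<psi> (b + a * t) * cnj (\<psi> t))"
    using lborel_integral_real_affine[OF assms, of "\<lambda>t. \<psi> t * cnj (\<psi> ((t - b) / a))" b] assms by simp
  also have "(LINT t|lborel. \<psi> (b + a * t) * cnj (\<psi> t)) = cnj (LINT t|lborel. \<psi> t * cnj (\<psi> (a * t + b)))"
    by (subst Bochner_Integration.integral_cnj[symmetric]) (simp add: mult.commute add.commute)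
  finally have "cmod (W (b, a)) = \<bar>a\<bar> powr (- 1 / 2) * \<bar>a\<bar> * cmod (LINT t|lborel. \<psi> t * cnj (\<psi> (a * t + b)))"
    by (simp add: W_eq norm_mult)
  also have "cmod (LINT t|lborel. \<psi> t * cnj (\<psi> (a * t + b)))
      = \<bar>a\<bar> ^ L * cmod (LINT t|lborel. primitive L t * cnj (d L (a * t + b)))"
    using correlation_by_parts[of 1 a 0 b] assms by simp
  also have "\<bar>a\<bar> powr (- 1 / 2) * \<bar>a\<bar> * (\<bar>a\<bar> ^ L * cmod (LINT t|lborel. primitive L t * cnj (d L (a * t + b))))
      = \<bar>a\<bar> powr (- 1 / 2 + 1 + L) * cmod (LINT t|lborel. primitive L t * cnj (d L (a * t + b)))"
    using assms by (simp only: powr_add) (simp add: powr_realpow)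
  finally show ?thesis by simp
qed

text \<open>The substitution \<open>t = \<delta> + \<tau> * s\<close> removes the group element from
  the second factor and moves it to the first. The slopes are then \<open>\<tau>\<close> and
  \<open>1 / a\<close>, whose quotient gives the negative powers.\<close>

lemma norm_W_large_scale:
  assumes "a \<noteq> 0" "\<tau> \<noteq> 0"
  shows "cmod (W (aff_mult (\<delta>, \<tau>) (b, a))) = \<bar>\<tau>\<bar> powr (1 / 2 - L) * \<bar>a\<bar> powr (- 1 / 2 - L) *
    cmod (LINT t|lborel. primitive L (\<tau> * t + \<delta>) * cnj (d L ((t - b) / a)))"
proof -
  have eq: "(\<delta> + \<tau> * t - (\<delta> + \<tau> * b)) / (\<tau> * a) = 1 / a * t + (- b / a)" for t
    using assms by (simp add: field_simps)
  have "(LINT t|lborel. \<psi> t * cnj (\<psi> ((t - (\<delta> + \<tau> * b)) / (\<tau> * a))))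
      = \<bar>\<tau>\<bar> *\<^sub>R (LINT t|lborel. \<psi> (\<tau> * t + \<delta>) * cnj (\<psi> (1 / a * t + (- b / a))))"
    using lborel_integral_real_affine[OF assms(2), of "\<lambda>t. \<psi> t * cnj (\<psi> ((t - (\<delta> + \<tau> * b)) / (\<tau> * a)))" \<delta>]
    unfolding eq by (simp add: add.commute)
  then have "cmod (W (aff_mult (\<delta>, \<tau>) (b, a)))
      = \<bar>\<tau> * a\<bar> powr (- 1 / 2) * (\<bar>\<tau>\<bar> * cmod (LINT t|lborel. \<psi> (\<tau> * t + \<delta>) * cnj (\<psi> (1 / a * t + (- b / a)))))"
    by (simp add: aff_mult_def W_eq norm_mult)
  also have "cmod (LINT t|lborel. \<psi> (\<tau> * t + \<delta>) * cnj (\<psi> (1 / a * t + (- b / a))))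
      = (\<bar>1 / a\<bar> / \<bar>\<tau>\<bar>) ^ L * cmod (LINT t|lborel. primitive L (\<tau> * t + \<delta>) * cnj (d L (1 / a * t + (- b / a))))"
    using assms by (intro correlation_by_parts) auto
  also have "(\<lambda>t. 1 / a * t + (- b / a)) = (\<lambda>t. (t - b) / a)"
    by (simp add: diff_divide_distrib)
  also have "(\<bar>1 / a\<bar> / \<bar>\<tau>\<bar>) ^ L = \<bar>\<tau>\<bar> powr (- real L) * \<bar>a\<bar> powr (- real L)"
    using assms by (simp add: powr_minus powr_realpow power_divide divide_simps power_mult_distrib)
  also have "\<bar>\<tau> * a\<bar> powr (- 1 / 2) * (\<bar>\<tau>\<bar> * (\<bar>\<tau>\<bar> powr (- real L) * \<bar>a\<bar> powr (- real L) * x))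
      = \<bar>\<tau>\<bar> powr (- 1 / 2 + 1 + - L) * \<bar>a\<bar> powr (- 1 / 2 + - L) * x" for x
    using assms by (simp only: powr_add abs_mult powr_mult) simp
  finally show ?thesis by simp
qed

lemma psi_bounded: "\<exists>C. \<forall>t. cmod (\<psi> t) \<le> C"
proof (intro exI allI)
  fix t
  show "cmod (\<psi> t) \<le> cmod (\<psi> 0) + (LINT t|lborel. cmod (d 1 t))"
    using bounded_by_integrable_derivative[of \<psi> "d 1" t 0] d_deriv[of 0] d_integrable[of 1] L_pos
      norm_triangle_sub[of "\<psi> t" "\<psi> 0"] by (simp add: d_0)
qed

text \<open>Dominated convergence applies, since \<open>\<psi>\<close> is bounded, integrable and
  continuous. Continuity is what supplies measurability of \<open>W\<close> and of its
  oscillation.\<close>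

lemma continuous_on_W: "continuous_on aff W"
proof -
  obtain C where C: "\<And>t. cmod (\<psi> t) \<le> C" using psi_bounded by blast
  have cont: "continuous_on UNIV \<psi>" using moments by (simp add: vanishing_moments_def)
  have "continuous_on aff (\<lambda>x. of_real (\<bar>snd x\<bar> powr (- 1 / 2)) * (LINT t|lborel. \<psi> t * cnj (\<psi> ((t - fst x) / snd x))))"
  proof (intro continuous_intros continuous_on_of_real)
    show "continuous_on aff (\<lambda>x. LINT t|lborel. \<psi> t * cnj (\<psi> ((t - fst x) / snd x)))"
      unfolding continuous_on_sequentially
    proof (intro allI ballI impI; elim conjE)
      fix x and xs :: "nat \<Rightarrow> real \<times> real"
      assume x: "x \<in> aff" and lim: "xs \<longlonglongrightarrow> x"
      show "((\<lambda>x. LINT t|lborel. \<psi> t * cnj (\<psi> ((t - fst x) / snd x))) \<circ> xs)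
          \<longlonglongrightarrow> (LINT t|lborel. \<psi> t * cnj (\<psi> ((t - fst x) / snd x)))"
        unfolding o_def
      proof (rule integral_dominated_convergence)
        show "integrable lborel (\<lambda>t. cmod (\<psi> t) * C)"
          using d_integrable[of 0] by (simp add: d_0)
        show "AE t in lborel. (\<lambda>n. \<psi> t * cnj (\<psi> ((t - fst (xs n)) / snd (xs n)))) \<longlonglongrightarrow> \<psi> t * cnj (\<psi> ((t - fst x) / snd x))"
          using x lim by (intro AE_I2 tendsto_intros continuous_on_tendsto_compose[OF cont]) (auto simp: aff_def)
        show "AE t in lborel. norm (\<psi> t * cnj (\<psi> ((t - fst (xs n)) / snd (xs n)))) \<le> cmod (\<psi> t) * C" for n
          using C by (intro AE_I2) (simp add: norm_mult mult_left_mono)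
      qed measurable
    qed
  qed (auto simp: aff_def)
  then show ?thesis
    by (rule continuous_on_eq) (auto simp: W_eq)
qed

text \<open>One \<open>K\<close> serves all of \<open>U\<close> and all admissible \<rho>. For each
  fixed \<open>a\<close> it is a constant times a correlation of two nonnegative functions, so its
  integral in \<open>b\<close> factorises.\<close>

lemma W_majorant:
  assumes U: "compact U" "U \<subseteq> aff"
  obtains K where "K \<in> borel_measurable borel"
    "\<And>u x. u \<in> U \<Longrightarrow> x \<in> aff \<Longrightarrow> ennreal (cmod (W (aff_mult u x))) \<le> K x"
    "\<And>\<rho>. 0 \<le> \<rho> \<Longrightarrow> \<rho> < L - 1 / 2 \<Longrightarrow> (\<integral>\<^sup>+ x. K x * ennreal (aff_weight \<rho> x) \<partial>aff_haar) < \<infinity>"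
proof -
  obtain h1 where h1 [measurable]: "h1 \<in> borel_measurable borel" and h1_fin: "(\<integral>\<^sup>+ s. h1 s \<partial>lborel) < \<infinity>"
    and h1_ge: "\<And>\<delta> \<tau> s. (\<delta>, \<tau>) \<in> U \<Longrightarrow> ennreal (cmod (d L (\<tau> * s + \<delta>))) \<le> h1 s"
    using radially_dominated_uniform_affine[OF d_dominated U] by blast
  obtain h2 where h2 [measurable]: "h2 \<in> borel_measurable borel" and h2_fin: "(\<integral>\<^sup>+ s. h2 s \<partial>lborel) < \<infinity>"
    and h2_ge: "\<And>\<delta> \<tau> s. (\<delta>, \<tau>) \<in> U \<Longrightarrow> ennreal (cmod (primitive L (\<tau> * s + \<delta>))) \<le> h2 s"
    using radially_dominated_uniform_affine[OF primitive_dominated U] by blast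
  \<comment> \<open>The bound \<open>A\<close> for \<open>m\<close> absorbs the powers of
    \<open>\<bar>\<tau>\<bar>\<close> in both representations; it exists because \<tau> stays away
    from 0 on the compact set \<open>U\<close>.\<close>
  define m where "m = (\<lambda>u::real \<times> real. \<bar>snd u\<bar> powr (1 / 2 + L) + \<bar>snd u\<bar> powr (1 / 2 - L))"
  have "continuous_on U m"
    unfolding m_def using U(2) by (intro continuous_intros) (auto simp: aff_def)
  then have "bounded (m ` U)"
    using U(1) compact_continuous_image compact_imp_bounded by blast
  then obtain A where A: "A > 0" "\<And>u. u \<in> U \<Longrightarrow> \<bar>m u\<bar> \<le> A"
    unfolding bounded_pos by auto
  let ?P = "\<lambda>t. ennreal (cmod (primitive L t))" and ?D = "\<lambda>t. ennreal (cmod (d L t))"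
  have P_fin: "(\<integral>\<^sup>+ t. ?P t \<partial>lborel) < \<infinity>" and D_fin: "(\<integral>\<^sup>+ t. ?D t \<partial>lborel) < \<infinity>"
    using primitive_integrable[of L] d_integrable[of L] by (simp_all add: integrable_iff_bounded)
  \<comment> \<open>In \<open>K1\<close> the derivative is replaced by its majorant over
    \<open>U\<close>, in \<open>K2\<close> the primitive is, according to the factor on which the
    group element acts.\<close>
  define K1 where "K1 = (\<lambda>x. \<integral>\<^sup>+ t. ?P t * h1 (snd x * t + fst x) \<partial>lborel)"
  define K2 where "K2 = (\<lambda>x. \<integral>\<^sup>+ t. h2 t * ?D ((t - fst x) / snd x) \<partial>lborel)"
  define K where "K = (\<lambda>x. ennreal A * (if \<bar>snd x\<bar> \<le> 1 then ennreal (\<bar>snd x\<bar> powr (1 / 2 + L)) * K1 x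
    else ennreal (\<bar>snd x\<bar> powr (- 1 / 2 - L)) * K2 x))"
  have K12_meas: "K1 \<in> borel_measurable borel" "K2 \<in> borel_measurable borel"
    unfolding K1_def K2_def borel_prod[symmetric] by measurable
  have K_meas: "K \<in> borel_measurable borel"
    unfolding K_def K1_def K2_def borel_prod[symmetric] by measurable
  have K_ge: "ennreal (cmod (W (aff_mult u x))) \<le> K x" if "u \<in> U" "x \<in> aff" for u x
  proof -
    obtain \<delta> \<tau> b a where u: "u = (\<delta>, \<tau>)" and x: "x = (b, a)" by (cases u, cases x)
    have nz: "a \<noteq> 0" "\<tau> \<noteq> 0" and uU: "(\<delta>, \<tau>) \<in> U"
      using that U(2) by (auto simp: u x aff_def)
    have "\<bar>\<tau>\<bar> powr (1 / 2 + L) + \<bar>\<tau>\<bar> powr (1 / 2 - L) \<le> A" using A(2)[OF uU] by (simp add: m_def)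
    then have tau: "\<bar>\<tau>\<bar> powr (1 / 2 + L) \<le> A" "\<bar>\<tau>\<bar> powr (1 / 2 - L) \<le> A"
      using powr_ge_zero[of "\<bar>\<tau>\<bar>" "1 / 2 + L"] powr_ge_zero[of "\<bar>\<tau>\<bar>" "1 / 2 - L"] by linarith+
    show ?thesis
    proof (cases "\<bar>a\<bar> \<le> 1")
      case True
      have "cmod (W (aff_mult u x)) = \<bar>\<tau>\<bar> powr (1 / 2 + L) * \<bar>a\<bar> powr (1 / 2 + L) *
          cmod (LINT t|lborel. primitive L t * cnj (d L (\<tau> * (a * t + b) + \<delta>)))"
        using norm_W_small_scale[of "\<tau> * a" "\<delta> + \<tau> * b"] nz
        by (simp add: u x aff_mult_def abs_mult powr_mult algebra_simps)
      also have "ennreal \<dots> \<le> ennreal (A * \<bar>a\<bar> powr (1 / 2 + L) *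
          cmod (LINT t|lborel. primitive L t * cnj (d L (\<tau> * (a * t + b) + \<delta>))))"
        using tau by (intro ennreal_leI mult_right_mono) auto
      also have "\<dots> = ennreal A * (ennreal (\<bar>a\<bar> powr (1 / 2 + L)) *
          ennreal (cmod (LINT t|lborel. primitive L t * cnj (d L (\<tau> * (a * t + b) + \<delta>)))))"
        using A(1) by (simp add: ennreal_mult mult.assoc)
      also have "\<dots> \<le> ennreal A * (ennreal (\<bar>a\<bar> powr (1 / 2 + L)) * K1 (b, a))"
        unfolding K1_def fst_conv snd_conv
        by (intro mult_left_mono ennreal_norm_integral_mult_cnj_le h1_ge[OF uU]) auto
      finally show ?thesis using True by (simp add: K_def x)
    next
      case False
      have "cmod (W (aff_mult u x)) = \<bar>\<tau>\<bar> powr (1 / 2 - L) * \<bar>a\<bar> powr (- 1 / 2 - L) *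
          cmod (LINT t|lborel. primitive L (\<tau> * t + \<delta>) * cnj (d L ((t - b) / a)))"
        unfolding u x by (rule norm_W_large_scale[OF nz])
      also have "ennreal \<dots> \<le> ennreal (A * \<bar>a\<bar> powr (- 1 / 2 - L) *
          cmod (LINT t|lborel. primitive L (\<tau> * t + \<delta>) * cnj (d L ((t - b) / a))))"
        using tau by (intro ennreal_leI mult_right_mono) auto
      also have "\<dots> = ennreal A * (ennreal (\<bar>a\<bar> powr (- 1 / 2 - L)) *
          ennreal (cmod (LINT t|lborel. primitive L (\<tau> * t + \<delta>) * cnj (d L ((t - b) / a)))))"
        using A(1) by (simp add: ennreal_mult mult.assoc)
      also have "\<dots> \<le> ennreal A * (ennreal (\<bar>a\<bar> powr (- 1 / 2 - L)) * K2 (b, a))"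
        unfolding K2_def fst_conv snd_conv
        by (intro mult_left_mono ennreal_norm_integral_mult_cnj_le h2_ge[OF uU]) auto
      finally show ?thesis using False by (simp add: K_def x)
    qed
  qed
  let ?I1 = "(\<integral>\<^sup>+ t. ?P t \<partial>lborel) * (\<integral>\<^sup>+ s. h1 s \<partial>lborel)"
  let ?I2 = "(\<integral>\<^sup>+ s. h2 s \<partial>lborel) * (\<integral>\<^sup>+ t. ?D t \<partial>lborel)"
  have int_K1: "(\<integral>\<^sup>+ b. K1 (b, a) \<partial>lborel) = ?I1" for a
  proof -
    have "(\<integral>\<^sup>+ b. K1 (b, a) \<partial>lborel) = (\<integral>\<^sup>+ t. \<integral>\<^sup>+ b. ?P t * h1 (a * t + b) \<partial>lborel \<partial>lborel)"
      unfolding K1_def fst_conv snd_conv by (rule lborel_pair.Fubini'[symmetric]) measurable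
    also have "\<dots> = (\<integral>\<^sup>+ t. ?P t * (\<integral>\<^sup>+ s. h1 s \<partial>lborel) \<partial>lborel)"
    proof (rule nn_integral_cong)
      fix t
      show "(\<integral>\<^sup>+ b. ?P t * h1 (a * t + b) \<partial>lborel) = ?P t * (\<integral>\<^sup>+ s. h1 s \<partial>lborel)"
        using nn_integral_real_affine[OF h1, of 1 "a * t"] by (simp add: nn_integral_cmult)
    qed
    finally show ?thesis by (simp add: nn_integral_multc)
  qed
  \<comment> \<open>In \<open>K2\<close> the variable \<open>b\<close> enters divided by
    \<open>a\<close>, which costs a factor \<open>\<bar>a\<bar>\<close>; in \<open>K1\<close> it
    enters as a plain translation, at no cost.\<close>
  have int_K2: "(\<integral>\<^sup>+ b. K2 (b, a) \<partial>lborel) = ennreal \<bar>a\<bar> * ?I2" if "a \<noteq> 0" for a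
  proof -
    have "(\<integral>\<^sup>+ b. K2 (b, a) \<partial>lborel) = (\<integral>\<^sup>+ t. \<integral>\<^sup>+ b. h2 t * ?D ((t - b) / a) \<partial>lborel \<partial>lborel)"
      unfolding K2_def fst_conv snd_conv by (rule lborel_pair.Fubini'[symmetric]) measurable
    also have "\<dots> = (\<integral>\<^sup>+ t. h2 t * (ennreal \<bar>a\<bar> * (\<integral>\<^sup>+ s. ?D s \<partial>lborel)) \<partial>lborel)"
    proof (rule nn_integral_cong)
      fix t
      show "(\<integral>\<^sup>+ b. h2 t * ?D ((t - b) / a) \<partial>lborel) = h2 t * (ennreal \<bar>a\<bar> * (\<integral>\<^sup>+ s. ?D s \<partial>lborel))"
        using nn_integral_real_affine[of "\<lambda>b. ?D ((t - b) / a)" "- a" t] that by (simp add: nn_integral_cmult)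
    qed
    finally show ?thesis by (simp add: nn_integral_multc ac_simps)
  qed
  have "(\<integral>\<^sup>+ x. K x * ennreal (aff_weight \<rho> x) \<partial>aff_haar) < \<infinity>" if rho: "0 \<le> \<rho>" "\<rho> < L - 1 / 2" for \<rho>
  proof -
    \<comment> \<open>The exponent \<open>L - \<rho> - 3 / 2\<close> exceeds -1 exactly when
      \<open>\<rho> < L - 1 / 2\<close>. At large scales \<open>\<rho> - L - 3 / 2 < - 1\<close>
      amounts to the weaker \<open>\<rho> < L + 1 / 2\<close>.\<close>
    have small: "\<bar>a\<bar> powr (1 / 2 + L) * ((\<bar>a\<bar> powr \<rho> + \<bar>a\<bar> powr (- \<rho>)) * (1 / a\<^sup>2)) \<le> 2 * \<bar>a\<bar> powr (L - \<rho> - 3 / 2)"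
      if "a \<noteq> 0" "\<bar>a\<bar> \<le> 1" for a :: real
    proof -
      have "\<bar>a\<bar> powr \<rho> \<le> \<bar>a\<bar> powr (- \<rho>)" using that rho by (intro powr_mono') auto
      then have "\<bar>a\<bar> powr (1 / 2 + L) * ((\<bar>a\<bar> powr \<rho> + \<bar>a\<bar> powr (- \<rho>)) * (1 / a\<^sup>2))
          \<le> \<bar>a\<bar> powr (1 / 2 + L) * ((2 * \<bar>a\<bar> powr (- \<rho>)) * (1 / a\<^sup>2))"
        by (intro mult_left_mono mult_right_mono) auto
      also have "\<dots> = 2 * \<bar>a\<bar> powr ((1 / 2 + L) + - \<rho> + - 2)"
      proof -
        have sq: "1 / a\<^sup>2 = \<bar>a\<bar> powr (- 2)" using that by (simp add: powr_minus powr_numeral divide_inverse)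
        show ?thesis unfolding sq by (simp only: powr_add ac_simps)
      qed
      also have "(1 / 2 + L) + - \<rho> + - 2 = L - \<rho> - 3 / 2" by simp
      finally show ?thesis .
    qed
    have large: "\<bar>a\<bar> powr (- 1 / 2 - L) * (\<bar>a\<bar> * ((\<bar>a\<bar> powr \<rho> + \<bar>a\<bar> powr (- \<rho>)) * (1 / a\<^sup>2))) \<le> 2 * \<bar>a\<bar> powr (\<rho> - L - 3 / 2)"
      if "1 \<le> \<bar>a\<bar>" for a :: real
    proof -
      have "\<bar>a\<bar> powr (- \<rho>) \<le> \<bar>a\<bar> powr \<rho>" using that rho by (intro powr_mono) auto
      then have "\<bar>a\<bar> powr (- 1 / 2 - L) * (\<bar>a\<bar> * ((\<bar>a\<bar> powr \<rho> + \<bar>a\<bar> powr (- \<rho>)) * (1 / a\<^sup>2)))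
          \<le> \<bar>a\<bar> powr (- 1 / 2 - L) * (\<bar>a\<bar> * ((2 * \<bar>a\<bar> powr \<rho>) * (1 / a\<^sup>2)))"
        by (intro mult_left_mono mult_right_mono) auto
      also have "\<dots> = 2 * \<bar>a\<bar> powr ((- 1 / 2 - L) + 1 + \<rho> + - 2)"
      proof -
        have sq: "1 / a\<^sup>2 = \<bar>a\<bar> powr (- 2)" using that by (simp add: powr_minus powr_numeral divide_inverse)
        have one: "\<bar>a\<bar> powr 1 = \<bar>a\<bar>" by simp
        show ?thesis unfolding sq powr_add one by (simp only: ac_simps)
      qed
      also have "(- 1 / 2 - L) + 1 + \<rho> + - 2 = \<rho> - L - 3 / 2" by simp
      finally show ?thesis by simp
    qed
    let ?f1 = "\<lambda>a. indicator {- 1..1} a * ennreal (\<bar>a\<bar> powr (L - \<rho> - 3 / 2))"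
    let ?f2 = "\<lambda>a. indicator {a. 1 \<le> \<bar>a\<bar>} a * ennreal (\<bar>a\<bar> powr (\<rho> - L - 3 / 2))"
    have w_meas: "(\<lambda>x. ennreal (aff_weight \<rho> x)) \<in> borel_measurable borel"
      unfolding aff_weight_def borel_prod[symmetric] by measurable
    have section_meas: "(\<lambda>b. F (b, a)) \<in> borel_measurable borel" if "F \<in> borel_measurable borel"
      for a :: real and F :: "real \<times> real \<Rightarrow> ennreal"
      by (rule measurable_compose[OF _ that]) (intro borel_measurable_continuous_onI continuous_intros)
    have "(\<integral>\<^sup>+ x. K x * ennreal (aff_weight \<rho> x) \<partial>aff_haar)
        = (\<integral>\<^sup>+ a. \<integral>\<^sup>+ b. K (b, a) * ennreal (aff_weight \<rho> (b, a)) * ennreal (1 / a\<^sup>2) \<partial>lborel \<partial>lborel)"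
      using K_meas w_meas by (intro nn_integral_aff_haar borel_measurable_times_ennreal)
    also have "\<dots> \<le> (\<integral>\<^sup>+ a. ennreal A * (ennreal 2 * ?I1) * ?f1 a + ennreal A * (ennreal 2 * ?I2) * ?f2 a \<partial>lborel)"
    proof (intro nn_integral_mono)
      fix a :: real
      define w where "w = (\<bar>a\<bar> powr \<rho> + \<bar>a\<bar> powr (- \<rho>)) * (1 / a\<^sup>2)"
      have w0: "w \<ge> 0" by (simp add: w_def)
      have "(\<integral>\<^sup>+ b. K (b, a) * ennreal (aff_weight \<rho> (b, a)) * ennreal (1 / a\<^sup>2) \<partial>lborel)
          = (\<integral>\<^sup>+ b. K (b, a) * ennreal w \<partial>lborel)"
        unfolding w_def by (subst ennreal_mult) (auto simp: aff_weight_def mult.assoc)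
      also have "\<dots> = (\<integral>\<^sup>+ b. K (b, a) \<partial>lborel) * ennreal w"
        using section_meas[OF K_meas] by (intro nn_integral_multc) simp
      also have "\<dots> \<le> ennreal A * (ennreal 2 * ?I1) * ?f1 a + ennreal A * (ennreal 2 * ?I2) * ?f2 a"
      proof -
        consider "a = 0" | "a \<noteq> 0" "\<bar>a\<bar> \<le> 1" | "1 < \<bar>a\<bar>" by linarith
        then show ?thesis
        proof cases
          \<comment> \<open>Here \<open>w\<close> is 0, again because
            \<open>1 / 0 = 0\<close>.\<close>
          case 1
          then show ?thesis by (simp add: w_def)
        next
          case 2
          have "(\<integral>\<^sup>+ b. K (b, a) \<partial>lborel) = ennreal A * (ennreal (\<bar>a\<bar> powr (1 / 2 + L)) * ?I1)"
            using 2 section_meas[OF K12_meas(1)] by (simp add: K_def nn_integral_cmult int_K1)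
          then have "(\<integral>\<^sup>+ b. K (b, a) \<partial>lborel) * ennreal w = ennreal A * ?I1 * ennreal (\<bar>a\<bar> powr (1 / 2 + L) * w)"
            using w0 by (simp add: ennreal_mult ac_simps)
          also have "\<dots> \<le> ennreal A * ?I1 * ennreal (2 * \<bar>a\<bar> powr (L - \<rho> - 3 / 2))"
            unfolding w_def by (intro mult_left_mono ennreal_leI small 2) auto
          also have "\<dots> = ennreal A * (ennreal 2 * ?I1) * ?f1 a"
            using 2 by (subst ennreal_mult) (auto simp: ac_simps abs_le_iff)
          finally show ?thesis by (rule order_trans) simp
        next
          case 3
          have "(\<integral>\<^sup>+ b. K (b, a) \<partial>lborel) = ennreal A * (ennreal (\<bar>a\<bar> powr (- 1 / 2 - L)) * (ennreal \<bar>a\<bar> * ?I2))"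
            using 3 section_meas[OF K12_meas(2)] int_K2[of a] by (simp add: K_def nn_integral_cmult)
          then have "(\<integral>\<^sup>+ b. K (b, a) \<partial>lborel) * ennreal w = ennreal A * ?I2 * ennreal (\<bar>a\<bar> powr (- 1 / 2 - L) * (\<bar>a\<bar> * w))"
            using w0 by (simp add: ennreal_mult ac_simps)
          also have "\<dots> \<le> ennreal A * ?I2 * ennreal (2 * \<bar>a\<bar> powr (\<rho> - L - 3 / 2))"
            unfolding w_def using 3 by (intro mult_left_mono ennreal_leI large) auto
          also have "\<dots> = ennreal A * (ennreal 2 * ?I2) * ?f2 a"
            using 3 by (subst ennreal_mult) (auto simp: ac_simps)
          finally show ?thesis by (rule order_trans) simp
        qed
      qed
      finally show "(\<integral>\<^sup>+ b. K (b, a) * ennreal (aff_weight \<rho> (b, a)) * ennreal (1 / a\<^sup>2) \<partial>lborel)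
        \<le> ennreal A * (ennreal 2 * ?I1) * ?f1 a + ennreal A * (ennreal 2 * ?I2) * ?f2 a" .
    qed
    also have "\<dots> = ennreal A * (ennreal 2 * ?I1) * (\<integral>\<^sup>+ a. ?f1 a \<partial>lborel) + ennreal A * (ennreal 2 * ?I2) * (\<integral>\<^sup>+ a. ?f2 a \<partial>lborel)"
      by (subst nn_integral_add) (simp_all add: nn_integral_cmult)
    also have "\<dots> < \<infinity>"
    proof -
      have "(\<integral>\<^sup>+ a. ?f1 a \<partial>lborel) < \<infinity>" by (rule nn_integral_powr_near_0) (use rho in simp)
      moreover have "(\<integral>\<^sup>+ a. ?f2 a \<partial>lborel) < \<infinity>" by (rule nn_integral_powr_near_infinity) (use rho in linarith)
      ultimately show ?thesis using P_fin D_fin h1_fin h2_fin by (simp add: ennreal_mult_less_top)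
    qed
    finally show ?thesis .
  qed
  with K_meas K_ge show ?thesis by (rule that)
qed

text \<open>Taking the neutral element for \<open>u\<close>, the majorant bounds \<open>W\<close>
  itself; the triangle inequality then bounds the oscillation by \<open>2 * K x\<close>.\<close>

lemma W_in_aff_L1_and_osc:
  assumes U: "aff_compact_nbhd U" and rho: "0 \<le> \<rho>" "\<rho> < L - 1 / 2"
  shows "W \<in> aff_L1 \<rho>" and "osc U W \<in> aff_L1_ennreal \<rho>"
proof -
  have cU: "compact U" "U \<subseteq> aff" and one: "(0, 1) \<in> U"
    using U interior_subset by (auto simp: aff_compact_nbhd_def)
  obtain K where K: "K \<in> borel_measurable borel"
    and W_le: "\<And>u x. u \<in> U \<Longrightarrow> x \<in> aff \<Longrightarrow> ennreal (cmod (W (aff_mult u x))) \<le> K x"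
    and fin: "(\<integral>\<^sup>+ x. K x * ennreal (aff_weight \<rho> x) \<partial>aff_haar) < \<infinity>"
    using W_majorant[OF cU] rho by metis
  have W_le': "ennreal (cmod (W x)) \<le> K x" if "x \<in> aff" for x
    using W_le[OF one that] by (simp add: aff_mult_def)
  have W_meas: "W \<in> borel_measurable aff_haar"
  proof -
    have "(\<lambda>x. if x \<in> aff then W x else 0) \<in> borel_measurable borel"
      by (rule borel_measurable_continuous_on_if) (use continuous_on_W in auto)
    from aff_haar_measurable_of_borel[OF this] show ?thesis
      by (rule measurable_cong[THEN iffD1, rotated]) simp
  qed
  have "(\<integral>\<^sup>+ x. ennreal (cmod (W x)) * ennreal (aff_weight \<rho> x) \<partial>aff_haar)
      \<le> (\<integral>\<^sup>+ x. K x * ennreal (aff_weight \<rho> x) \<partial>aff_haar)"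
    using W_le' by (intro nn_integral_mono mult_right_mono) auto
  with fin W_meas show "W \<in> aff_L1 \<rho>" unfolding aff_L1_def by (auto intro: le_less_trans)
  have osc: "osc U W x \<le> 2 * K x" if "x \<in> aff" for x
  proof (rule osc_le[OF continuous_on_W cU that])
    fix u assume "u \<in> U"
    have "ennreal (cmod (W (aff_mult u x) - W x)) \<le> ennreal (cmod (W (aff_mult u x)) + cmod (W x))"
      by (intro ennreal_leI norm_triangle_ineq4)
    also have "\<dots> \<le> K x + K x"
      using W_le[OF \<open>u \<in> U\<close> that] W_le'[OF that] by (simp add: add_mono)
    finally show "ennreal (cmod (W (aff_mult u x) - W x)) \<le> 2 * K x" by (simp add: mult_2)
  qed
  have "(\<integral>\<^sup>+ x. osc U W x * ennreal (aff_weight \<rho> x) \<partial>aff_haar)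
      \<le> (\<integral>\<^sup>+ x. 2 * (K x * ennreal (aff_weight \<rho> x)) \<partial>aff_haar)"
    unfolding mult.assoc[symmetric] using osc by (intro nn_integral_mono mult_right_mono) auto
  also have "\<dots> = 2 * (\<integral>\<^sup>+ x. K x * ennreal (aff_weight \<rho> x) \<partial>aff_haar)"
  proof (rule nn_integral_cmult)
    have "(\<lambda>x. ennreal (aff_weight \<rho> x)) \<in> borel_measurable borel"
      unfolding aff_weight_def borel_prod[symmetric] by measurable
    with K show "(\<lambda>x. K x * ennreal (aff_weight \<rho> x)) \<in> borel_measurable aff_haar"
      by (intro aff_haar_measurable_of_borel borel_measurable_times_ennreal)
  qed
  also have "\<dots> < \<infinity>" using fin by (simp add: ennreal_mult_less_top)
  finally show "osc U W \<in> aff_L1_ennreal \<rho>"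
    unfolding aff_L1_ennreal_def using measurable_osc[OF continuous_on_W cU] by simp
qed

end

section \<open>From the hypotheses to the abstract setting\<close>

lemma nth_derivative_Suc:
  "nth_derivative (Suc k) f = (\<lambda>t. vector_derivative (nth_derivative k f) (at t))"
  by (simp add: nth_derivative_def)

theorem proposition6p1p5:
  fixes L :: nat and \<psi> :: "real \<Rightarrow> complex" and U :: "(real \<times> real) set"
  assumes "L \<ge> 1"
    and "\<psi> \<in> L2"
    and "\<And>k. k \<le> L \<Longrightarrow> integrable lebesgue (\<lambda>t. \<bar>t\<bar> ^ k * cmod (\<psi> t))"
    and "\<And>k. k < L \<Longrightarrow> (LINT t|lebesgue. of_real (t ^ k) * \<psi> t) = 0"
    and "times_differentiable L \<psi>"
    and "\<And>k. k \<le> L \<Longrightarrow> integrable lebesgue (nth_derivative k \<psi>)"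
    and "aff_compact_nbhd U"
    and "(\<integral>\<^sup>+ t. (SUP (\<delta>, \<tau>)\<in>U. ennreal (cmod (nth_derivative L \<psi> (\<tau> * t + \<delta>)))) \<partial>lebesgue) < \<infinity>"
  shows "\<forall>\<rho>::real. 0 \<le> \<rho> \<and> \<rho> < real L - 1 / 2 \<longrightarrow>
    osc U (wavelet_transform \<psi> \<psi>) \<in> aff_L1_ennreal \<rho> \<and> \<psi> \<in> B_space \<rho>"
proof -
  have psi: "nth_derivative 0 \<psi> = \<psi>" by (simp add: nth_derivative_def)
  have deriv: "(nth_derivative k \<psi> has_vector_derivative nth_derivative (Suc k) \<psi> t) (at t)" if "k < L" for k t
    using assms(5) that unfolding times_differentiable_def nth_derivative_Suc
    by (simp add: vector_derivative_works[symmetric])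
  have cont: "continuous_on UNIV \<psi>"
    using deriv[of 0] assms(1) has_vector_derivative_continuous
    by (fastforce simp: psi intro: continuous_at_imp_continuous_on)
  have [measurable]: "\<psi> \<in> borel_measurable borel"
    using cont by (rule borel_measurable_continuous_onI)
  \<comment> \<open>Borel measurability is what lets integrability pass from \<open>lebesgue\<close>
    to \<open>lborel\<close>.\<close>
  have meas: "nth_derivative k \<psi> \<in> borel_measurable borel" if "k \<le> L" for k
  proof (cases k)
    case (Suc j)
    show ?thesis
      unfolding Suc by (rule borel_measurable_vector_derivative, rule deriv) (use Suc that in simp)
  qed (simp add: psi)
  have moments: "vanishing_moments L \<psi>"
    unfolding vanishing_moments_def
  proof (intro conjI allI impI)
    show "continuous_on UNIV \<psi>" by (rule cont)
    fix m
    have m: "(\<lambda>t. of_real (t ^ m) * \<psi> t) \<in> borel_measurable lborel" by measurable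
    show "integrable lborel (\<lambda>t. of_real (t ^ m) * \<psi> t)" if "m \<le> L"
    proof (rule integrable_norm_cancel)
      have "(\<lambda>t. \<bar>t\<bar> ^ m * cmod (\<psi> t)) \<in> borel_measurable lborel" by measurable
      from integrable_completion[OF this] assms(3)[OF that]
      show "integrable lborel (\<lambda>t. norm (of_real (t ^ m) * \<psi> t))"
        by (simp add: norm_mult norm_power)
    qed (rule m)
    show "(LINT t|lborel. of_real (t ^ m) * \<psi> t) = 0" if "m < L"
      using assms(4)[OF that] unfolding integral_completion[OF m] .
  qed
  interpret smooth_wavelet L \<psi> "\<lambda>k. nth_derivative k \<psi>"
  proof
    show "integrable lborel (nth_derivative k \<psi>)" if "k \<le> L" for k
      using integrable_completion[of "nth_derivative k \<psi>" lborel] assms(6)[OF that] meas[OF that] by simp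
    \<comment> \<open>The supremum over \<open>U\<close> may fail to be Borel, but
      \<open>nn_integral\<close> takes the same value on a measure and its completion for arbitrary
      functions.\<close>
    show "radially_dominated (nth_derivative L \<psi>)"
      using assms(7,8) by (intro radially_dominated_of_sup_integrable[of U])
        (simp_all add: aff_compact_nbhd_def nn_integral_completion)
  qed (use assms(1) moments psi deriv in simp_all)
  show ?thesis
  proof (intro allI impI)
    fix \<rho> :: real
    assume "0 \<le> \<rho> \<and> \<rho> < real L - 1 / 2"
    with W_in_aff_L1_and_osc[OF assms(7)]
    have "wavelet_transform \<psi> \<psi> \<in> aff_L1 \<rho>" "osc U (wavelet_transform \<psi> \<psi>) \<in> aff_L1_ennreal \<rho>" by auto
    with assms(2,7) show "osc U (wavelet_transform \<psi> \<psi>) \<in> aff_L1_ennreal \<rho> \<and> \<psi> \<in> B_space \<rho>"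
      unfolding B_space_def by blast
  qed
qed

end
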